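(* Let $x_0\in[a,b]$, let $p_1,p_2,q,r_{11},r_{12},r_{21},r_{22}\in L^1(a,b)$ be complex-valued, and let $\lambda\in\mathbb{C}$. Put $B=\begin{pmatrix} 0 & 1 \\ -1 & 0 \end{pmatrix}$, $P=\begin{pmatrix} p_1 & q \\ q & p_2 \end{pmatrix}$, $R=\begin{pmatrix} r_{11} & r_{12} \\ r_{21} & r_{22} \end{pmatrix}$. Suppose that the homogeneous system $BY'+P(x)Y=0$ possesses a solution $Y_0=(f,g)^T$ with $f,g$ absolutely continuous on $[a,b]$ and such that $$\left\{\frac{p_2}{f^2},\ \frac{p_1}{g^2},\ r_{11}\frac fg,\ r_{22}\frac gf\right\}\subset L^1(a,b).$$ Let $X^{(n)},Y^{(n)},\widetilde X^{(n)},\widetilde Y^{(n)}$, $n\ge0$, be the formal powers constructed from $(f,g)$ and $x_0$ as in the context. Then the general solution of the system $$B\frac{dY}{dx}+P(x)Y=\lambda R(x)Y$$ has the form $Y=c_1Y_1+c_2Y_2$, where $c_1,c_2$ are arbitrary complex constants and $Y_1=(u_1,v_1)^T$, $Y_2=(u_2,v_2)^T$ are given by $$\begin{pmatrix} u_1 \\ v_1 \end{pmatrix}=\sum_{n=0}^\infty\frac{\lambda^n}{n!}\begin{pmatrix} f\widetilde X^{(n)} \\ g\widetilde Y^{(n)} \end{pmatrix},\qquad \begin{pmatrix} u_2 \\ v_2 \end{pmatrix}=\sum_{n=0}^\infty\frac{\lambda^n}{n!}\begin{pmatrix} fX^{(n)} \\ g Y^{(n)} \end{pmatrix}.$$ Both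 series converge uniformly on $[a,b]$, and $$Y_1(x_0)=\begin{pmatrix} f(x_0) \\ 0 \end{pmatrix},\qquad Y_2(x_0)=\begin{pmatrix} 0 \\ g(x_0) \end{pmatrix}.$$
   Context: A vector function $(u,v)^T$ is called a solution of a system with $L^1$ coefficients if both $u,v:[a,b]\to\mathbb{C}$ are absolutely continuous on $[a,b]$ and satisfy the system almost everywhere. The integrability assumption on the quotients includes that they are genuinely defined almost everywhere, i.e. $f\ne0$ and $g\neq0$ almost everywhere on $[a,b]$ (no convention such as $1/0=0$ is used). Formal powers. Given $f,g$ and $x_0$, define $$X^{(0)}(x)=f(x_0)g(x_0)\int_{x_0}^x\frac{p_2(s)}{f^2(s)}\,ds,\qquad Y^{(0)}(x)=1+f(x_0)g(x_0)\int_{x_0}^x\frac{p_1(s)}{g^2(s)}\,ds,$$ and recursively for $n\ge0$ $$Z^{(n)}(x)=\int_{x_0}^x\Bigl(X^{(n)}(s)\bigl(f^2(s)r_{11}(s)+g^2(s)r_{21}(s)\bigr)+Y^{(n)}(s)\bigl(f^2(s)r_{12}(s)+g^2(s)r_{22}(s)\bigr)\Bigr)ds,$$ $$X^{(n+1)}(x)=(n+1)\int_{x_0}^x\Bigl(-r_{21}(s)X^{(n)}(s)-r_{22}(s)\frac{g(s)}{f(s)}Y^{(n)}(s)+\frac{p_2(s)}{f^2(s)}Z^{(n)}(s)\Bigr)ds,$$ $$Y^{(n+1)}(x)=(n+1)\int_{x_0}^x\Bigl(r_{11}(s)\frac{f(s)}{g(s)}X^{(n)}(s)+r_{12}(s)Y^{(n)}(s)+\frac{p_1(s)}{g^2(s)}Z^{(n)}(s)\Bigr)ds.$$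 Similarly set $$\widetilde X^{(0)}(x)=1-f(x_0)g(x_0)\int_{x_0}^x\frac{p_2(s)}{f^2(s)}\,ds,\qquad \widetilde Y^{(0)}(x)=-f(x_0)g(x_0)\int_{x_0}^x\frac{p_1(s)}{g^2(s)}\,ds,$$ and define $\widetilde Z^{(n)},\widetilde X^{(n+1)},\widetilde Y^{(n+1)}$, $n\ge0$, by the same recursive formulas with $X^{(n)},Y^{(n)},Z^{(n)}$ replaced by $\widetilde X^{(n)},\widetilde Y^{(n)},\widetilde Z^{(n)}$. The superscript in $Y^{(n)}$ is an index (scalar function), not a derivative.
   Formalization: In the recursion for Z^(n) (and its tilde version) the weights of the off-diagonal entries are corrected: f g r_21 replaces g^2 r_21 and f g r_12 replaces f^2 r_12; with the printed weights the series do not solve the system in general. *)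

theory Defs
  imports "HOL-Analysis.Analysis"
begin

definition abs_cont_on :: "real \<Rightarrow> real \<Rightarrow> (real \<Rightarrow> complex) \<Rightarrow> bool" where
  "abs_cont_on a b u \<longleftrightarrow>
     (\<forall>\<epsilon>>0. \<exists>\<delta>>0. \<forall>I :: (real \<times> real) set.
        finite I \<longrightarrow>
        (\<forall>(s, t)\<in>I. a \<le> s \<and> s \<le> t \<and> t \<le> b) \<longrightarrow>
        disjoint_family_on (\<lambda>(s, t). {s<..<t}) I \<longrightarrow>
        (\<Sum>(s, t)\<in>I. t - s) < \<delta> \<longrightarrow>
        (\<Sum>(s, t)\<in>I. norm (u t - u s)) < \<epsilon>)"

definition mat2 :: "complex \<Rightarrow> complex \<Rightarrow> complex \<Rightarrow> complex \<Rightarrow> complex ^ 2 ^ 2" where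
  "mat2 m11 m12 m21 m22 = vector [vector [m11, m12], vector [m21, m22]]"

(* Y is a solution of B Y' + P(x) Y = h(x) on [a,b]. The coefficients are only L^1, so the
   system is required almost everywhere. The derivative is taken within [a,b], so values
   of Y outside [a,b] play no role. *)
definition solves ::
  "real \<Rightarrow> real \<Rightarrow> (real \<Rightarrow> complex ^ 2 ^ 2) \<Rightarrow> (real \<Rightarrow> complex ^ 2) \<Rightarrow> (real \<Rightarrow> complex ^ 2) \<Rightarrow> bool"
  where
  "solves a b P h Y \<longleftrightarrow>
     (\<forall>i. abs_cont_on a b (\<lambda>x. Y x $ i)) \<and>
     (AE x\<in>{a..b} in lebesgue. \<exists>Y'.
        (Y has_vector_derivative Y') (at x within {a..b}) \<and>
        mat2 0 1 (-1) 0 *v Y' + P x *v Y x = h x)"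

(* Oriented: for x < x0 this is minus the integral over (x, x0). *)
definition int_from :: "real \<Rightarrow> (real \<Rightarrow> complex) \<Rightarrow> real \<Rightarrow> complex" where
  "int_from x0 h x = interval_lebesgue_integral lebesgue (ereal x0) (ereal x) h"

(* If u = f X, v = g Y solve the system with parameter lam, then W = f g (Y - X) satisfies
     W' = lam (f^2 r11 X + f g r12 Y + f g r21 X + g^2 r22 Y);
   Z is the corresponding primitive. The off-diagonal entries r12, r21 therefore carry the
   weight f g; with f^2 r12 and g^2 r21 instead, the resulting series would not solve the
   system in general. *)
definition Z_of ::
  "(real \<Rightarrow> complex) \<Rightarrow> (real \<Rightarrow> complex) \<Rightarrow> (real \<Rightarrow> complex ^ 2 ^ 2) \<Rightarrow> real \<Rightarrow>
   (real \<Rightarrow> complex) \<Rightarrow> (real \<Rightarrow> complex) \<Rightarrow> real \<Rightarrow> complex"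
  where
  "Z_of f g R x0 X Y =
     int_from x0 (\<lambda>s. X s * ((f s)\<^sup>2 * R s $ 1 $ 1 + f s * g s * R s $ 2 $ 1)
                    + Y s * (f s * g s * R s $ 1 $ 2 + (g s)\<^sup>2 * R s $ 2 $ 2))"

(* The pair (X^(n), Y^(n)) generated from the initial pair (X0, Y0). *)
primrec powers ::
  "(real \<Rightarrow> complex) \<Rightarrow> (real \<Rightarrow> complex) \<Rightarrow> (real \<Rightarrow> complex ^ 2 ^ 2) \<Rightarrow> (real \<Rightarrow> complex ^ 2 ^ 2) \<Rightarrow>
   real \<Rightarrow> (real \<Rightarrow> complex) \<Rightarrow> (real \<Rightarrow> complex) \<Rightarrow> nat \<Rightarrow>
   (real \<Rightarrow> complex) \<times> (real \<Rightarrow> complex)"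
  where
  "powers f g P R x0 X0 Y0 0 = (X0, Y0)"
| "powers f g P R x0 X0 Y0 (Suc n) =
     (let (X, Y) = powers f g P R x0 X0 Y0 n; Z = Z_of f g R x0 X Y in
       (\<lambda>x. of_nat (n + 1) *
          int_from x0 (\<lambda>s. - R s $ 2 $ 1 * X s - R s $ 2 $ 2 * (g s / f s) * Y s
                           + P s $ 2 $ 2 / (f s)\<^sup>2 * Z s) x,
        \<lambda>x. of_nat (n + 1) *
          int_from x0 (\<lambda>s. R s $ 1 $ 1 * (f s / g s) * X s + R s $ 1 $ 2 * Y s
                           + P s $ 1 $ 1 / (g s)\<^sup>2 * Z s) x))"

definition formal_powers ::
  "(real \<Rightarrow> complex) \<Rightarrow> (real \<Rightarrow> complex) \<Rightarrow> (real \<Rightarrow> complex ^ 2 ^ 2) \<Rightarrow> (real \<Rightarrow> complex ^ 2 ^ 2) \<Rightarrow>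
   real \<Rightarrow> nat \<Rightarrow> (real \<Rightarrow> complex) \<times> (real \<Rightarrow> complex)"
  where
  "formal_powers f g P R x0 =
     powers f g P R x0
       (\<lambda>x. f x0 * g x0 * int_from x0 (\<lambda>s. P s $ 2 $ 2 / (f s)\<^sup>2) x)
       (\<lambda>x. 1 + f x0 * g x0 * int_from x0 (\<lambda>s. P s $ 1 $ 1 / (g s)\<^sup>2) x)"

definition formal_powers_tilde ::
  "(real \<Rightarrow> complex) \<Rightarrow> (real \<Rightarrow> complex) \<Rightarrow> (real \<Rightarrow> complex ^ 2 ^ 2) \<Rightarrow> (real \<Rightarrow> complex ^ 2 ^ 2) \<Rightarrow>
   real \<Rightarrow> nat \<Rightarrow> (real \<Rightarrow> complex) \<times> (real \<Rightarrow> complex)"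
  where
  "formal_powers_tilde f g P R x0 =
     powers f g P R x0
       (\<lambda>x. 1 - f x0 * g x0 * int_from x0 (\<lambda>s. P s $ 2 $ 2 / (f s)\<^sup>2) x)
       (\<lambda>x. - (f x0 * g x0) * int_from x0 (\<lambda>s. P s $ 1 $ 1 / (g s)\<^sup>2) x)"

definition series_term ::
  "(real \<Rightarrow> complex) \<Rightarrow> (real \<Rightarrow> complex) \<Rightarrow> (nat \<Rightarrow> (real \<Rightarrow> complex) \<times> (real \<Rightarrow> complex)) \<Rightarrow>
   complex \<Rightarrow> nat \<Rightarrow> real \<Rightarrow> complex ^ 2"
  where
  "series_term f g XY lam n x =
     (lam ^ n / fact n) *s vector [f x * fst (XY n) x, g x * snd (XY n) x]"

end

theory Submission
  imports Defs
begin

text \<open>From \<open>f' = (q + (p2 / f\<^sup>2) f g) f\<close> and \<open>g' = - (q + (p1 / g\<^sup>2) f g) g\<close>, linear equations with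
  integrable coefficients, it follows that \<open>f\<close> and \<open>g\<close> have no zeros at all. So one may write
  \<open>u = f X\<close>, \<open>v = g Y\<close>; with \<open>W = f g (Y - X)\<close> the system becomes
  \<open>X' = (p2 / f\<^sup>2) W - \<lambda> (r21 X + r22 (g / f) Y)\<close>, \<open>Y' = (p1 / g\<^sup>2) W + \<lambda> (r11 (f / g) X + r12 Y)\<close>,
  where \<open>W'\<close> is \<open>\<lambda>\<close> times the integrand of \<open>Z\<close>. Integrating from \<open>x0\<close> turns this into a
  fixed-point equation \<open>(X, Y) = (X0, Y0) + \<lambda> T (X, Y)\<close> with a Volterra operator \<open>T\<close>, whose starting
  pair is the combination of the two initial formal powers with coefficients \<open>X x0\<close> and \<open>Y x0\<close>.
  The formal powers are \<open>n!\<close> times the iterates of \<open>T\<close>, so the series in the theorem are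
  Neumann series; in an exponentially weighted norm \<open>\<lambda> T\<close> is a contraction.\<close>

section \<open>Absolutely continuous functions and indefinite integrals\<close>

text \<open>Passing between the system and its integral form takes both halves of Lebesgue's
  fundamental theorem of calculus: an absolutely continuous function is recovered from its almost
  everywhere derivative, and the indefinite integral of an integrable function is absolutely
  continuous with the integrand as derivative almost everywhere. Both are derived from gauge
  integrals. Zeros of \<open>f\<close> and \<open>g\<close> are an obstacle: the hypotheses exclude
  them only almost everywhere, whereas \<open>u / f\<close> and \<open>v / g\<close> have to be
  absolutely continuous on the whole interval. The coefficients are merely integrable, so a weight
  \<open>exp (- K |x - x0|)\<close>, which suits bounded coefficients, cannot give the contraction.
  The exponent is instead \<open>K\<close> times the modulus of the integral from \<open>x0\<close>
  to \<open>x\<close> of the sum of the norms of all coefficients. All solutions are captured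
  because the pair \<open>(X, Y)\<close> is determined by its values at \<open>x0\<close>, which
  enter the fixed-point equation linearly; the two series belong to the initial values
  \<open>(1, 0)\<close> and \<open>(0, 1)\<close>.\<close>

lemma abs_cont_onD_family:
  assumes "abs_cont_on a b u" and "0 < \<epsilon>"
  obtains \<delta> where "0 < \<delta>"
    and "\<And>J s t. \<lbrakk>finite (J :: 'i set); \<And>j. j \<in> J \<Longrightarrow> a \<le> s j \<and> s j \<le> t j \<and> t j \<le> b;
            disjoint_family_on (\<lambda>j. {s j<..<t j}) J; (\<Sum>j\<in>J. t j - s j) < \<delta>\<rbrakk>
          \<Longrightarrow> (\<Sum>j\<in>J. norm (u (t j) - u (s j))) < \<epsilon>"
proof -
  obtain \<delta> where "0 < \<delta>" and \<delta>: "\<And>I. \<lbrakk>finite I; \<forall>(s, t)\<in>I. a \<le> s \<and> s \<le> t \<and> t \<le> b;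
        disjoint_family_on (\<lambda>(s, t). {s<..<t}) I; (\<Sum>(s, t)\<in>I. t - s) < \<delta>\<rbrakk>
        \<Longrightarrow> (\<Sum>(s, t)\<in>I. norm (u t - u s)) < \<epsilon>"
    using assms unfolding abs_cont_on_def by meson
  have "(\<Sum>j\<in>J. norm (u (t j) - u (s j))) < \<epsilon>"
    if J: "finite J" "\<And>j. j \<in> J \<Longrightarrow> a \<le> s j \<and> s j \<le> t j \<and> t j \<le> b"
      "disjoint_family_on (\<lambda>j. {s j<..<t j}) J" "(\<Sum>j\<in>J. t j - s j) < \<delta>"
    for J :: "'i set" and s t
  proof -
    \<comment> \<open>The definition sums over a set of pairs, so a family that repeats a pair would
      lose terms. Only degenerate intervals can repeat in a disjoint family; they contribute nothing
      and are dropped.\<close>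
    let ?J = "{j\<in>J. s j < t j}" and ?h = "\<lambda>j. (s j, t j)"
    have inj: "inj_on ?h ?J"
    proof (rule inj_onI, rule ccontr)
      fix i j assume ij: "i \<in> ?J" "j \<in> ?J" "?h i = ?h j" "i \<noteq> j"
      then have "{s i<..<t i} \<inter> {s j<..<t j} = {}"
        using J(3)[unfolded disjoint_family_on_def, rule_format, of i j] by auto
      moreover have "(s i + t i) / 2 \<in> {s i<..<t i} \<inter> {s j<..<t j}"
        using ij by (auto simp: field_simps)
      ultimately show False by blast
    qed
    have eq0: "s j = t j" if "j \<in> J - ?J" for j
      using that J(2)[of j] by (force simp: not_less)
    have "(\<Sum>(s, t)\<in>?h ` ?J. norm (u t - u s)) < \<epsilon>"
    proof (rule \<delta>)
      show "disjoint_family_on (\<lambda>(s, t). {s<..<t}) (?h ` ?J)"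
        using J(3) unfolding disjoint_family_on_def by fastforce
      have "(\<Sum>(s, t)\<in>?h ` ?J. t - s) = (\<Sum>j\<in>?J. t j - s j)"
        by (subst sum.reindex[OF inj]) simp
      also have "\<dots> = (\<Sum>j\<in>J. t j - s j)"
        by (rule sum.mono_neutral_left) (use J(1) eq0 in \<open>auto simp del: mem_Collect_eq\<close>)
      finally show "(\<Sum>(s, t)\<in>?h ` ?J. t - s) < \<delta>"
        using J(4) by simp
    qed (use J in auto)
    moreover have "(\<Sum>(s, t)\<in>?h ` ?J. norm (u t - u s)) = (\<Sum>j\<in>?J. norm (u (t j) - u (s j)))"
      by (subst sum.reindex[OF inj]) simp
    moreover have "\<dots> = (\<Sum>j\<in>J. norm (u (t j) - u (s j)))"
      by (rule sum.mono_neutral_left) (use J(1) eq0 in \<open>auto simp del: mem_Collect_eq\<close>)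
    ultimately show ?thesis by simp
  qed
  with \<open>0 < \<delta>\<close> show thesis by (rule that)
qed

section \<open>The fundamental theorem of calculus for absolutely continuous functions\<close>

lemma sum_interval_lengths_le_measure:
  fixes s t :: "'i \<Rightarrow> real"
  assumes "finite J" "\<And>j. j \<in> J \<Longrightarrow> s j \<le> t j" "disjoint_family_on (\<lambda>j. {s j<..<t j}) J"
    and "\<And>j. j \<in> J \<Longrightarrow> {s j<..<t j} \<subseteq> U" "U \<in> lmeasurable"
  shows "(\<Sum>j\<in>J. t j - s j) \<le> measure lebesgue U"
proof -
  have "(\<Sum>j\<in>J. t j - s j) = (\<Sum>j\<in>J. measure lebesgue {s j<..<t j})"
    using assms(2) by (intro sum.cong) auto
  also have "\<dots> = measure lebesgue (\<Union>j\<in>J. {s j<..<t j})"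
    using assms by (intro measure_finite_Union[symmetric]) auto
  also have "\<dots> \<le> measure lebesgue U"
    using assms by (intro measure_mono_fmeasurable) auto
  finally show ?thesis .
qed

text \<open>A gauge integral argument: around a point of differentiability the gauge is the usual one,
  while the exceptional null set is enclosed in an open set so small that the increments over the
  subintervals tagged there are controlled by absolute continuity.\<close>

lemma abs_cont_on_has_integral:
  assumes "a \<le> b" and ac: "abs_cont_on a b u"
    and der: "AE x\<in>{a..b} in lebesgue. (u has_vector_derivative k x) (at x within {a..b})"
  shows "(k has_integral (u b - u a)) {a..b}"
proof (cases "a = b")
  case True
  then show ?thesis by (simp add: has_integral_refl)
next
  case False
  with \<open>a \<le> b\<close> have ab: "a < b" by simp
  define N where "N = {x\<in>{a..b}. \<not> (u has_vector_derivative k x) (at x within {a..b})}"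
  obtain N' where "N' \<in> null_sets lebesgue"
    "{x \<in> space lebesgue. \<not> (x \<in> {a..b} \<longrightarrow> (u has_vector_derivative k x) (at x within {a..b}))} \<subseteq> N'"
    using der unfolding eventually_ae_filter by blast
  then have N: "negligible N"
    by (intro negligible_subset[of N' N]) (auto simp: negligible_iff_null_sets N_def)
  then have N0: "N \<in> null_sets lebesgue"
    by (simp add: negligible_iff_null_sets)
  \<comment> \<open>Replacing \<open>k\<close> by 0 on \<open>N\<close> keeps the integral and
    removes the Riemann term at a tag in \<open>N\<close>, so that only the increment of
    \<open>u\<close> has to be estimated there.\<close>
  let ?k = "\<lambda>x. if x \<in> N then 0 else k x"
  have "(?k has_integral (u b - u a)) {a..b}"
    unfolding has_integral_factor_content box_real[symmetric]
  proof safe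
    fix e :: real assume "e > 0"
    have "\<forall>x. \<exists>d>0. x \<in> {a..b} - N \<longrightarrow>
        (\<forall>y\<in>{a..b}. norm (y-x) < d \<longrightarrow> norm (u y - u x - (y-x) *\<^sub>R k x) \<le> e/2 * norm (y-x))"
    proof
      fix x show "\<exists>d>0. x \<in> {a..b} - N \<longrightarrow>
        (\<forall>y\<in>{a..b}. norm (y-x) < d \<longrightarrow> norm (u y - u x - (y-x) *\<^sub>R k x) \<le> e/2 * norm (y-x))"
      proof (cases "x \<in> {a..b} - N")
        case True
        then have "(u has_vector_derivative k x) (at x within {a..b})"
          by (auto simp: N_def)
        with \<open>e > 0\<close> show ?thesis
          unfolding has_vector_derivative_def has_derivative_within_alt
          by (metis half_gt_zero)
      qed (auto intro: exI[of _ 1])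
    qed
    from choice[OF this] obtain d where d: "\<And>x. 0 < d x"
      "\<And>x y. \<lbrakk>x \<in> {a..b} - N; y \<in> {a..b}; norm (y-x) < d x\<rbrakk>
          \<Longrightarrow> norm (u y - u x - (y-x) *\<^sub>R k x) \<le> e/2 * norm (y-x)"
      by blast
    have eab: "e/2 * (b-a) > 0" using \<open>e > 0\<close> ab by simp
    \<comment> \<open>The index type is that of tagged intervals, so the family is read off a tagged
      division directly. Tags in \<open>N\<close> may use half of the admissible error
      \<open>e * (b - a)\<close>.\<close>
    obtain \<delta> where "0 < \<delta>"
      and \<delta>: "\<And>J s t. \<lbrakk>finite (J :: (real \<times> real set) set);
            \<And>j. j \<in> J \<Longrightarrow> a \<le> s j \<and> s j \<le> t j \<and> t j \<le> b;
            disjoint_family_on (\<lambda>j. {s j<..<t j}) J; (\<Sum>j\<in>J. t j - s j) < \<delta>\<rbrakk>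
          \<Longrightarrow> (\<Sum>j\<in>J. norm (u (t j) - u (s j))) < e/2 * (b-a)"
      by (rule abs_cont_onD_family[OF ac eab, where 'i="real \<times> real set"]) blast
    obtain U where U: "open U" "N \<subseteq> U" "U - N \<in> lmeasurable" "emeasure lebesgue (U - N) < ennreal \<delta>"
      using sets_lebesgue_outer_open[OF null_setsD2[OF N0] \<open>0 < \<delta>\<close>] by blast
    have U': "U \<in> lmeasurable" "measure lebesgue U < \<delta>"
    proof -
      have "emeasure lebesgue U = emeasure lebesgue (U - N)"
        using N0 U(1) by (simp add: emeasure_Diff_null_set borel_open)
      with U(4) have less: "emeasure lebesgue U < ennreal \<delta>" by simp
      then show "U \<in> lmeasurable"
        using U(1) by (intro fmeasurableI) (auto simp: borel_open intro: less_trans)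
      show "measure lebesgue U < \<delta>"
        using less \<open>U \<in> lmeasurable\<close>
        by (simp add: emeasure_eq_measure2 ennreal_less_iff measure_nonneg)
    qed
    let ?\<gamma> = "\<lambda>x. if x \<in> N then U else ball x (d x)"
    show "\<exists>\<gamma>. gauge \<gamma> \<and> (\<forall>p. p tagged_division_of (cbox a b) \<and> \<gamma> fine p \<longrightarrow>
      norm ((\<Sum>(x, K)\<in>p. measure lborel K *\<^sub>R ?k x) - (u b - u a)) \<le> e * measure lborel (cbox a b))"
    proof (intro exI conjI allI impI)
      show "gauge ?\<gamma>"
        using U d(1) by (auto simp: gauge_def)
    next
      fix p assume "p tagged_division_of (cbox a b) \<and> ?\<gamma> fine p"
      then have ptag: "p tagged_division_of cbox a b" and finep: "?\<gamma> fine p" by auto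
      have ba: "b - a = (\<Sum>(x,K)\<in>p. Sup K - Inf K)" "u b - u a = (\<Sum>(x,K)\<in>p. u(Sup K) - u(Inf K))"
        using additive_tagged_division_1[where f= "\<lambda>x. x"] additive_tagged_division_1[where f= u]
              \<open>a \<le> b\<close> ptag by auto
      have fin: "finite p" using ptag by auto
      have K: "x \<in> K" "measure lborel K = Sup K - Inf K" "a \<le> Inf K" "Inf K \<le> x" "x \<le> Sup K" "Sup K \<le> b"
          "interior K = {Inf K<..<Sup K}" "Inf K \<in> K" "Sup K \<in> K" if xK: "(x, K) \<in> p" for x K
      proof -
        obtain c e where c: "K = cbox c e" "x \<in> K" "K \<subseteq> cbox a b"
          using ptag xK by (metis tagged_division_ofD(2-4))
        moreover from this have "c \<le> e" by auto
        ultimately show "x \<in> K" "measure lborel K = Sup K - Inf K" "a \<le> Inf K" "Inf K \<le> x" "x \<le> Sup K" "Sup K \<le> b"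
          "interior K = {Inf K<..<Sup K}" "Inf K \<in> K" "Sup K \<in> K"
          by (auto simp: interior_cbox)
      qed
      define p1 where "p1 = {(x,K)\<in>p. x \<in> N}"
      define p2 where "p2 = {(x,K)\<in>p. x \<notin> N}"
      have p12: "p = p1 \<union> p2" "p1 \<inter> p2 = {}" "finite p1" "finite p2" "p1 \<subseteq> p" "p2 \<subseteq> p"
        using fin by (auto simp: p1_def p2_def intro: finite_subset[OF _ fin])
      let ?T = "\<lambda>(x, K). measure lborel K *\<^sub>R ?k x - (u (Sup K) - u (Inf K))"
      have disj: "disjoint_family_on (\<lambda>j. {Inf (snd j)<..<Sup (snd j)}) p1"
      proof (unfold disjoint_family_on_def, intro ballI impI)
        fix i j assume ij: "i \<in> p1" "j \<in> p1" "i \<noteq> j"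
        then have "interior (snd i) \<inter> interior (snd j) = {}"
          using tagged_division_ofD(5)[OF ptag, of "fst i" "snd i" "fst j" "snd j"] p12 by auto
        then show "{Inf (snd i)<..<Sup (snd i)} \<inter> {Inf (snd j)<..<Sup (snd j)} = {}"
          using K(7)[of "fst i" "snd i"] K(7)[of "fst j" "snd j"] ij p12 by auto
      qed
      have inU: "{Inf (snd j)<..<Sup (snd j)} \<subseteq> U" if jp: "j \<in> p1" for j
      proof -
        obtain x L where j: "j = (x, L)" "(x, L) \<in> p" "x \<in> N"
          using jp unfolding p1_def by blast
        then have "L \<subseteq> U" using fineD[OF finep j(2)] by simp
        moreover have "{Inf L<..<Sup L} \<subseteq> L" using K(7)[OF j(2)] interior_subset[of L] by simp
        ultimately show ?thesis using j by auto
      qed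
      have len: "Inf (snd j) \<le> Sup (snd j)" "a \<le> Inf (snd j)" "Sup (snd j) \<le> b" if "j \<in> p1" for j
      proof -
        have "(fst j, snd j) \<in> p" using that p12 by auto
        from K[OF this] show "Inf (snd j) \<le> Sup (snd j)" "a \<le> Inf (snd j)" "Sup (snd j) \<le> b"
          by auto
      qed
      have "norm (sum ?T p1) \<le> (\<Sum>j\<in>p1. norm (u (Sup (snd j)) - u (Inf (snd j))))"
        by (rule sum_norm_le) (auto simp: p1_def norm_minus_commute)
      also have "\<dots> < e/2 * (b-a)"
      proof (rule \<delta>)
        show "(\<Sum>j\<in>p1. Sup (snd j) - Inf (snd j)) < \<delta>"
          by (rule le_less_trans[OF sum_interval_lengths_le_measure U'(2)])
            (use p12 disj inU len U' in auto)
      qed (use p12 disj len in auto)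
      finally have 1: "norm (sum ?T p1) < e/2 * (b-a)" .
      have "norm (sum ?T p2) \<le> (\<Sum>(x, K)\<in>p2. e/2 * (Sup K - Inf K))"
      proof (rule sum_norm_le, safe)
        fix x L assume "(x, L) \<in> p2"
        then have xL: "(x, L) \<in> p" "x \<notin> N" by (auto simp: p2_def)
        note Kx = K[OF xL(1)]
        have ball: "L \<subseteq> ball x (d x)"
          using fineD[OF finep xL(1)] xL(2) by simp
        have x: "x \<in> {a..b} - N" using Kx xL by auto
        \<comment> \<open>Straddle estimate: both end points are compared with the tag, and since
          the tag lies between them the two errors add up to a multiple of the length of
          \<open>L\<close>.\<close>
        have "norm (measure lborel L *\<^sub>R ?k x - (u (Sup L) - u (Inf L)))
          = norm ((u (Inf L) - u x - (Inf L - x) *\<^sub>R k x) - (u (Sup L) - u x - (Sup L - x) *\<^sub>R k x))"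
          using xL(2) unfolding Kx(2) by (simp add: algebra_simps)
        also have "\<dots> \<le> norm (u (Inf L) - u x - (Inf L - x) *\<^sub>R k x) + norm (u (Sup L) - u x - (Sup L - x) *\<^sub>R k x)"
          by (rule norm_triangle_ineq4)
        also have "\<dots> \<le> e/2 * norm (Inf L - x) + e/2 * norm (Sup L - x)"
          using ball Kx
          by (intro add_mono d(2)[OF x]) (auto simp: dist_real_def subset_iff)
        also have "\<dots> = e/2 * (Sup L - Inf L)"
          using Kx by (simp add: field_simps)
        finally show "norm (measure lborel L *\<^sub>R ?k x - (u (Sup L) - u (Inf L))) \<le> e/2 * (Sup L - Inf L)" .
      qed
      also have "\<dots> \<le> (\<Sum>(x, K)\<in>p. e/2 * (Sup K - Inf K))"
      proof (rule sum_mono2[OF fin p12(6)])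
        fix i assume "i \<in> p - p2"
        then show "0 \<le> (case i of (x, K) \<Rightarrow> e/2 * (Sup K - Inf K))"
          using K(4,5)[of "fst i" "snd i"] \<open>e > 0\<close> by (cases i) auto
      qed
      also have "\<dots> = e/2 * (b - a)"
        by (simp add: ba(1) sum_distrib_left split_def)
      finally have 2: "norm (sum ?T p2) \<le> e/2 * (b - a)" .
      have "(\<Sum>(x, K)\<in>p. measure lborel K *\<^sub>R ?k x) - (u b - u a) = sum ?T p"
        unfolding ba(2) by (simp add: split_def sum_subtractf)
      also have "\<dots> = sum ?T p1 + sum ?T p2"
        by (subst p12(1)) (rule sum.union_disjoint[OF p12(3,4,2)])
      finally have eq: "(\<Sum>(x, K)\<in>p. measure lborel K *\<^sub>R ?k x) - (u b - u a) = sum ?T p1 + sum ?T p2" .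
      have "norm (sum ?T p1 + sum ?T p2) \<le> e/2 * (b - a) + e/2 * (b - a)"
        by (rule norm_triangle_mono[OF less_imp_le[OF 1] 2])
      also have "\<dots> = e * (b - a)" by (simp add: field_simps)
      finally show "norm ((\<Sum>(x, K)\<in>p. measure lborel K *\<^sub>R ?k x) - (u b - u a)) \<le> e * measure lborel (cbox a b)"
        using \<open>a \<le> b\<close> unfolding eq by simp
    qed
  qed
  then show ?thesis
    by (rule has_integral_spike[OF N, rotated]) auto
qed

text \<open>By Vitali's covering theorem the points where the difference quotients stay \<open>1 / (n + 1)\<close> off
  are covered, up to a null set, by disjoint intervals; Henstock's lemma bounds their total length.\<close>

lemma integral_has_vector_derivative_ae:
  fixes k :: "real \<Rightarrow> 'v::euclidean_space"
  assumes k: "k integrable_on {a..b}"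
  shows "AE x\<in>{a..b} in lebesgue.
           ((\<lambda>t. integral {a..t} k) has_vector_derivative k x) (at x within {a..b})"
proof -
  define F where "F = (\<lambda>t. integral {a..t} k)"
  have F: "F y - F x = integral {x..y} k" if "a \<le> x" "x \<le> y" "y \<le> b" for x y
  proof -
    have "k integrable_on {a..y}"
      by (rule integrable_on_subinterval[OF k]) (use that in auto)
    then show ?thesis
      unfolding F_def using Henstock_Kurzweil_Integration.integral_combine[OF that(1,2)] by (metis add_diff_cancel_left')
  qed
  define bad where "bad n x y \<longleftrightarrow> norm (y - x) < real (Suc n) * norm (F y - F x - (y-x) *\<^sub>R k x)"
    for n x y
  define E where "E n = {x\<in>{a..b}. \<forall>d>0. \<exists>y\<in>{a..b}. y \<noteq> x \<and> norm (y-x) < d \<and> bad n x y}" for n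
  have negE: "negligible (E n)" for n
    unfolding negligible_outer
  proof (intro allI impI)
    fix e :: real assume "0 < e"
    \<comment> \<open>A bad interval is shorter than \<open>n + 1\<close> times its Henstock error,
      so an error sum below \<open>e'\<close> limits the total length to
      \<open>e / 2\<close>.\<close>
    define e' where "e' = e / (2 * real (Suc n))"
    have "e' > 0" using \<open>0 < e\<close> by (simp add: e'_def)
    with k obtain \<gamma> where "gauge \<gamma>" and \<gamma>: "\<And>p. \<lbrakk>p tagged_partial_division_of (cbox a b); \<gamma> fine p\<rbrakk> \<Longrightarrow>
             sum (\<lambda>(x,K). norm(measure lborel K *\<^sub>R k x - integral K k)) p < e'"
      by (rule Henstock_lemma[of k a b e', unfolded box_real]) (use that in \<open>auto simp: box_real\<close>)
    \<comment> \<open>An index is an oriented pair: the tag \<open>x\<close> is one end of the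
      interval, its bad partner \<open>y\<close> the other, on either side of \<open>x\<close>. The
      last condition makes the tagged interval fine.\<close>
    define I where "I = {(x, y). x \<in> {a..b} \<and> y \<in> {a..b} \<and> y \<noteq> x \<and> bad n x y \<and>
        {min x y..max x y} \<subseteq> \<gamma> x}"
    define c where "c = (\<lambda>(x::real, y). (x + y) / 2)"
    define r where "r = (\<lambda>(x::real, y). \<bar>x - y\<bar> / 2)"
    have cb: "cball (c i) (r i) = {min (fst i) (snd i)..max (fst i) (snd i)}" for i
      by (cases i; cases "fst i \<le> snd i")
        (auto simp: c_def r_def cball_eq_atLeastAtMost abs_if field_simps)
    obtain C where C: "countable C" "C \<subseteq> I"
     "pairwise (\<lambda>i j. disjnt (cball (c i) (r i)) (cball (c j) (r j))) C"
     "negligible (E n - (\<Union>i \<in> C. cball (c i) (r i)))"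
    proof (rule Vitali_covering_theorem_cballs[of I r "E n" c])
      show "0 < r i" if "i \<in> I" for i
        using that by (auto simp: I_def r_def)
      fix x d :: real assume "x \<in> E n" "0 < d"
      have "x \<in> \<gamma> x" "open (\<gamma> x)" using \<open>gauge \<gamma>\<close> by (auto simp: gauge_def)
      then obtain d' where d': "0 < d'" "ball x d' \<subseteq> \<gamma> x" by (metis open_contains_ball)
      obtain y where y: "y \<in> {a..b}" "y \<noteq> x" "norm (y-x) < min d d'" "bad n x y"
      proof -
        have "0 < min d d'" using \<open>0 < d\<close> \<open>0 < d'\<close> by simp
        then have "\<exists>y\<in>{a..b}. y \<noteq> x \<and> norm (y-x) < min d d' \<and> bad n x y"
          using \<open>x \<in> E n\<close> unfolding E_def by blast
        then show thesis using that by blast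
      qed
      have "{min x y..max x y} \<subseteq> ball x d'"
        using y by (auto simp: dist_real_def)
      then have "(x, y) \<in> I"
        using y d' \<open>x \<in> E n\<close> by (auto simp: I_def E_def)
      moreover have "x \<in> cball (c (x,y)) (r (x,y))" by (auto simp: cb)
      moreover have "r (x, y) < d" using y by (auto simp: r_def)
      ultimately show "\<exists>i. i \<in> I \<and> x \<in> cball (c i) (r i) \<and> r i < d" by blast
    qed (use that in blast)
    \<comment> \<open>Every finite part of the Vitali family is a fine tagged partial division, so
      Henstock's lemma applies to it. The bound does not depend on the part chosen and therefore
      passes to the countable union.\<close>
    have fin_le: "measure lebesgue (\<Union>i\<in>F'. cball (c i) (r i)) \<le> e / 2" if F': "F' \<subseteq> C" "finite F'" for F'
    proof -
      let ?h = "\<lambda>i. (fst i, cball (c i) (r i))"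
      have dj: "cball (c i) (r i) \<inter> cball (c j) (r j) = {}" if "i \<in> F'" "j \<in> F'" "i \<noteq> j" for i j
        using C(3) F' that by (auto simp: pairwise_def disjnt_def)
      have inI: "i \<in> I" if "i \<in> F'" for i using that F' C by auto
      have rpos: "fst i \<in> cball (c i) (r i)" for i by (simp add: cb)
      have inj: "inj_on ?h F'"
      proof (rule inj_onI, rule ccontr)
        fix i j assume ij: "i \<in> F'" "j \<in> F'" "?h i = ?h j" "i \<noteq> j"
        then have "fst i \<in> cball (c i) (r i) \<inter> cball (c j) (r j)"
          using rpos[of i] by blast
        with dj[OF ij(1,2,4)] show False by blast
      qed
      have "?h ` F' tagged_partial_division_of cbox a b"
      proof (unfold tagged_partial_division_of_def, intro conjI allI impI)
        show "finite (?h ` F')" using F' by simp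
        fix x K assume "(x, K) \<in> ?h ` F'"
        then obtain i where i: "i \<in> F'" "x = fst i" "K = cball (c i) (r i)" by auto
        then show "x \<in> K" by (simp add: cb)
        show "K \<subseteq> cbox a b" using inI[OF i(1)] i by (auto simp: cb I_def)
        show "\<exists>a b. K = cbox a b" using i by (auto simp: cb)
      next
        fix x K x' K' assume as: "(x, K) \<in> ?h ` F' \<and> (x', K') \<in> ?h ` F' \<and> (x, K) \<noteq> (x', K')"
        then have ne: "(x, K) \<noteq> (x', K')" by blast
        from as obtain i where i: "i \<in> F'" "x = fst i" "K = cball (c i) (r i)" by auto
        from as obtain j where j: "j \<in> F'" "x' = fst j" "K' = cball (c j) (r j)" by auto
        have "K \<inter> K' = {}" using i j ne dj[of i j] by auto
        then show "interior K \<inter> interior K' = {}"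
          using interior_subset by blast
      qed
      moreover have "\<gamma> fine (?h ` F')"
        using inI by (force simp: fine_def cb I_def)
      ultimately have "sum (\<lambda>(x,K). norm(measure lborel K *\<^sub>R k x - integral K k)) (?h ` F') < e'"
        by (rule \<gamma>)
      then have less: "(\<Sum>i\<in>F'. norm (measure lborel (cball (c i) (r i)) *\<^sub>R k (fst i) - integral (cball (c i) (r i)) k)) < e'"
        by (subst (asm) sum.reindex[OF inj]) simp
      have "measure lebesgue (\<Union>i\<in>F'. cball (c i) (r i)) \<le> (\<Sum>i\<in>F'. measure lebesgue (cball (c i) (r i)))"
        using F' by (intro measure_UNION_le) auto
      also have "\<dots> \<le> (\<Sum>i\<in>F'. real (Suc n) *
          norm (measure lborel (cball (c i) (r i)) *\<^sub>R k (fst i) - integral (cball (c i) (r i)) k))"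
      proof (rule sum_mono)
        fix i assume "i \<in> F'"
        then have iI: "i \<in> I" by (rule inI)
        obtain x y where i: "i = (x, y)" by (cases i)
        have xy: "x \<in> {a..b}" "y \<in> {a..b}" "y \<noteq> x" "bad n x y" using iI i by (auto simp: I_def)
        have m: "measure lebesgue (cball (c i) (r i)) = \<bar>y - x\<bar>"
          by (cases "x \<le> y") (auto simp: cb i)
        have "norm (measure lborel (cball (c i) (r i)) *\<^sub>R k (fst i) - integral (cball (c i) (r i)) k)
            = norm (F y - F x - (y-x) *\<^sub>R k x)"
        proof (cases "x \<le> y")
          case True
          then show ?thesis using F[of x y] xy by (simp add: cb i norm_minus_commute)
        next
          case False
          then show ?thesis using F[of y x] xy
            by (simp add: cb i algebra_simps)
        qed
        with m xy(4) show "measure lebesgue (cball (c i) (r i)) \<le> real (Suc n) *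
          norm (measure lborel (cball (c i) (r i)) *\<^sub>R k (fst i) - integral (cball (c i) (r i)) k)"
          unfolding bad_def by (simp del: of_nat_Suc)
      qed
      also have "\<dots> \<le> real (Suc n) * e'"
        using less by (simp add: sum_distrib_left[symmetric] del: of_nat_Suc)
      also have "\<dots> = e / 2" by (simp add: e'_def del: of_nat_Suc)
      finally show ?thesis .
    qed
    let ?V = "\<Union>i\<in>C. cball (c i) (r i)" and ?N = "E n - (\<Union>i \<in> C. cball (c i) (r i))"
    have V: "?V \<in> lmeasurable" "measure lebesgue ?V \<le> e / 2"
      using fmeasurable_UN_bound[OF C(1) lmeasurable_cball fin_le] measure_UN_bound[OF C(1) lmeasurable_cball fin_le]
      by blast+
    have N: "?N \<in> null_sets lebesgue" using C(4) by (simp add: negligible_iff_null_sets)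
    have "?V \<union> ?N \<in> lmeasurable"
      by (rule fmeasurable.Un[OF V(1) fmeasurableI_null_sets[OF N]])
    moreover have "measure lebesgue (?V \<union> ?N) = measure lebesgue ?V"
      by (rule measure_Un_null_set[OF fmeasurableD[OF V(1)] N])
    ultimately show "\<exists>T. E n \<subseteq> T \<and> T \<in> lmeasurable \<and> measure lebesgue T < e"
      using V(2) \<open>0 < e\<close> by (intro exI[of _ "?V \<union> ?N"] conjI) auto
  qed
  have "negligible (\<Union>n. E n)" using negE by (rule negligible_Union_nat)
  moreover have "(F has_vector_derivative k x) (at x within {a..b})"
    if x: "x \<in> {a..b}" "x \<notin> (\<Union>n. E n)" for x
    unfolding has_vector_derivative_def has_derivative_within_alt
  proof (intro conjI allI impI)
    show "bounded_linear (\<lambda>h. h *\<^sub>R k x)" by (rule bounded_linear_scaleR_left)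
    fix e :: real assume "0 < e"
    then obtain n where n: "inverse (real (Suc n)) < e" using reals_Archimedean by blast
    from x have "x \<notin> E n" by auto
    with x(1) obtain d where "d > 0" and d: "\<And>y. \<lbrakk>y \<in> {a..b}; y \<noteq> x; norm (y-x) < d\<rbrakk> \<Longrightarrow> \<not> bad n x y"
      unfolding E_def by blast
    have "norm (F y - F x - (y-x) *\<^sub>R k x) \<le> e * norm (y-x)" if y: "y \<in> {a..b}" "norm (y-x) < d" for y
    proof (cases "y = x")
      case False
      then have "real (Suc n) * norm (F y - F x - (y-x) *\<^sub>R k x) \<le> norm (y-x)"
        using d[OF y(1) _ y(2)] by (simp add: bad_def)
      then have "norm (F y - F x - (y-x) *\<^sub>R k x) \<le> inverse (real (Suc n)) * norm (y-x)"
        by (simp add: field_simps del: of_nat_Suc)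
      also have "\<dots> \<le> e * norm (y-x)" using n by (intro mult_right_mono) auto
      finally show ?thesis .
    qed simp
    with \<open>d > 0\<close> show "\<exists>d>0. \<forall>y\<in>{a..b}. norm (y-x) < d \<longrightarrow> norm (F y - F x - (y-x) *\<^sub>R k x) \<le> e * norm (y-x)"
      by blast
  qed
  ultimately show ?thesis
    unfolding F_def[symmetric] negligible_iff_null_sets
    by (intro AE_I'[of "\<Union>n. E n"]) auto
qed

text \<open>The open intervals are disjoint, so at each point at most one restriction of
  \<open>\<phi>\<close> to them is nonzero and their sum stays below \<open>\<phi>\<close>; end
  points do not affect the integrals.\<close>

lemma sum_integral_disjoint_le:
  fixes \<phi> :: "real \<Rightarrow> real" and I :: "(real \<times> real) set"
  assumes "finite I" "\<forall>(s, t)\<in>I. a \<le> s \<and> s \<le> t \<and> t \<le> b"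
    and dj: "disjoint_family_on (\<lambda>(s, t). {s<..<t}) I"
    and \<phi>: "\<phi> integrable_on {a..b}" "\<And>x. x \<in> {a..b} \<Longrightarrow> 0 \<le> \<phi> x"
  shows "(\<Sum>(s, t)\<in>I. integral {s..t} \<phi>) \<le> integral {a..b} \<phi>"
proof -
  let ?\<phi> = "\<lambda>i x. if x \<in> {fst i<..<snd i} then \<phi> x else 0"
  have i: "?\<phi> i integrable_on {a..b} \<and> integral {fst i..snd i} \<phi> = integral {a..b} (?\<phi> i)" if "i \<in> I" for i
  proof -
    have sub: "{fst i..snd i} \<subseteq> {a..b}" "{fst i<..<snd i} \<inter> {a..b} = {fst i<..<snd i}"
      using assms(2) that by fastforce+
    have "\<phi> integrable_on {fst i..snd i}"
      by (rule integrable_on_subinterval[OF \<phi>(1) sub(1)])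
    then have "\<phi> integrable_on {fst i<..<snd i}"
      by (simp add: integrable_on_open_interval_real)
    then show ?thesis
      using sub(2) integrable_restrict_Int[of "{fst i<..<snd i}" \<phi> "{a..b}"]
        integral_restrict_Int[of "{a..b}" "{fst i<..<snd i}" \<phi>]
      by (auto simp: integral_open_interval_real[of "fst i" "snd i"] simp del: greaterThanLessThan_iff)
  qed
  have "(\<Sum>(s, t)\<in>I. integral {s..t} \<phi>) = (\<Sum>j\<in>I. integral {a..b} (?\<phi> j))"
    using i by (auto intro!: sum.cong simp: split_def)
  also have "\<dots> = integral {a..b} (\<lambda>x. \<Sum>j\<in>I. ?\<phi> j x)"
    using i assms(1) by (intro integral_sum[symmetric]) auto
  also have "\<dots> \<le> integral {a..b} \<phi>"
  proof (rule integral_le)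
    show "(\<lambda>x. \<Sum>j\<in>I. ?\<phi> j x) integrable_on {a..b}"
      using i assms(1) by (intro integrable_sum) auto
    fix x assume x: "x \<in> {a..b}"
    show "(\<Sum>j\<in>I. ?\<phi> j x) \<le> \<phi> x"
    proof (cases "\<exists>j\<in>I. x \<in> {fst j<..<snd j}")
      case True
      then obtain j where j: "j \<in> I" "x \<in> {fst j<..<snd j}" by blast
      have "?\<phi> l x = 0" if "l \<in> I - {j}" for l
      proof -
        have "{fst l<..<snd l} \<inter> {fst j<..<snd j} = {}"
          using dj[unfolded disjoint_family_on_def, rule_format, of l j] that j(1) by (simp add: split_def)
        with j(2) show ?thesis by (metis disjoint_iff)
      qed
      then have "(\<Sum>j\<in>I. ?\<phi> j x) = ?\<phi> j x"
        using j assms(1) by (subst sum.remove[of _ j]) auto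
      then show ?thesis using \<phi>(2)[OF x] by simp
    next
      case False
      then have "(\<Sum>j\<in>I. ?\<phi> j x) = 0" by (intro sum.neutral) auto
      then show ?thesis using \<phi>(2)[OF x] by simp
    qed
  qed (use \<phi> in auto)
  finally show ?thesis .
qed

text \<open>Truncation at height \<open>n\<close>: by dominated convergence the part of
  \<open>norm (k x)\<close> above \<open>n\<close> has a small integral, and the part below
  contributes at most \<open>n\<close> times the total length of the intervals.\<close>

lemma abs_cont_on_integral:
  assumes k: "k absolutely_integrable_on {a..b}"
  shows "abs_cont_on a b (\<lambda>x. integral {a..x} k)"
  unfolding abs_cont_on_def
proof (intro allI impI)
  fix \<epsilon> :: real assume "0 < \<epsilon>"
  define T where "T n x = min (norm (k x)) (real n)" for n x
  have ki: "(\<lambda>x. norm (k x)) absolutely_integrable_on {a..b}"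
    using k by (rule absolutely_integrable_norm[unfolded o_def])
  then have kn: "(\<lambda>x. norm (k x)) integrable_on {a..b}"
    by (rule set_lebesgue_integral_eq_integral(1))
  have Ti: "T n integrable_on {a..b}" for n
  proof -
    have "(\<lambda>x. min (norm (k x)) (real n)) absolutely_integrable_on {a..b}"
      using ki by (rule absolutely_integrable_min_1) auto
    then show ?thesis
      unfolding T_def by (rule set_lebesgue_integral_eq_integral(1))
  qed
  have "(\<lambda>n. integral {a..b} (T n)) \<longlonglongrightarrow> integral {a..b} (\<lambda>x. norm (k x))"
  proof (rule dominated_convergence(2)[OF Ti kn])
    show "norm (T n x) \<le> norm (k x)" for n x by (simp add: T_def)
    fix x assume "x \<in> {a..b}"
    obtain N where "norm (k x) \<le> real N" using real_arch_simple by blast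
    then have "eventually (\<lambda>n. T n x = norm (k x)) sequentially"
      unfolding T_def eventually_sequentially by (intro exI[of _ N]) auto
    then show "(\<lambda>n. T n x) \<longlonglongrightarrow> norm (k x)"
      by (rule tendsto_eventually)
  qed
  then obtain n where n: "\<bar>integral {a..b} (T n) - integral {a..b} (\<lambda>x. norm (k x))\<bar> < \<epsilon> / 2"
    using \<open>0 < \<epsilon>\<close> unfolding lim_sequentially by (metis dist_real_def half_gt_zero order_refl)
  \<comment> \<open>\<open>Suc n\<close> keeps the quotient meaningful for
    \<open>n = 0\<close>.\<close>
  define \<delta> where "\<delta> = \<epsilon> / (2 * real (Suc n))"
  have "\<delta> > 0" using \<open>0 < \<epsilon>\<close> by (simp add: \<delta>_def)
  let ?D = "\<lambda>x. norm (k x) - T n x"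
  have Di: "?D integrable_on {a..b}" using kn Ti by (rule integrable_diff)
  show "\<exists>\<delta>>0. \<forall>I. finite I \<longrightarrow> (\<forall>(s, t)\<in>I. a \<le> s \<and> s \<le> t \<and> t \<le> b) \<longrightarrow>
    disjoint_family_on (\<lambda>(s, t). {s<..<t}) I \<longrightarrow> (\<Sum>(s, t)\<in>I. t - s) < \<delta> \<longrightarrow>
    (\<Sum>(s, t)\<in>I. norm (integral {a..t} k - integral {a..s} k)) < \<epsilon>"
  proof (intro exI[of _ \<delta>] conjI allI impI)
    fix I :: "(real \<times> real) set"
    assume I: "finite I" "\<forall>(s, t)\<in>I. a \<le> s \<and> s \<le> t \<and> t \<le> b"
      "disjoint_family_on (\<lambda>(s, t). {s<..<t}) I" "(\<Sum>(s, t)\<in>I. t - s) < \<delta>"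
    have le: "norm (integral {a..t} k - integral {a..s} k) \<le> integral {s..t} ?D + real n * (t - s)"
      if "(s, t) \<in> I" for s t
    proof -
      have st: "a \<le> s" "s \<le> t" "t \<le> b" using I(2) that by auto
      then have sub: "{s..t} \<subseteq> {a..b}" by auto
      have k': "k integrable_on {a..t}" "k integrable_on {s..t}"
        using k st by (auto intro!: integrable_on_subinterval[OF set_lebesgue_integral_eq_integral(1)[OF k]])
      have "integral {a..t} k - integral {a..s} k = integral {s..t} k"
        using Henstock_Kurzweil_Integration.integral_combine[OF st(1,2) k'(1)] by (metis add_diff_cancel_left')
      also have "norm \<dots> \<le> integral {s..t} (\<lambda>x. norm (k x))"
        by (rule integral_norm_bound_integral)
          (use k' integrable_on_subinterval[OF kn sub] in auto)
      also have "\<dots> = integral {s..t} ?D + integral {s..t} (T n)"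
        using integral_add[OF integrable_on_subinterval[OF Di sub] integrable_on_subinterval[OF Ti[of n] sub]]
        by simp
      also have "integral {s..t} (T n) \<le> integral {s..t} (\<lambda>x. real n)"
        by (rule integral_le) (use integrable_on_subinterval[OF Ti sub] in \<open>auto simp: T_def\<close>)
      also have "\<dots> = real n * (t - s)" using st by simp
      finally show ?thesis by simp
    qed
    have "(\<Sum>(s, t)\<in>I. norm (integral {a..t} k - integral {a..s} k))
        \<le> (\<Sum>(s, t)\<in>I. integral {s..t} ?D + real n * (t - s))"
      using le by (intro sum_mono) auto
    also have "\<dots> = (\<Sum>(s, t)\<in>I. integral {s..t} ?D) + real n * (\<Sum>(s, t)\<in>I. t - s)"
      by (simp add: split_def sum.distrib sum_distrib_left)
    also have "(\<Sum>(s, t)\<in>I. integral {s..t} ?D) \<le> integral {a..b} ?D"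
      by (rule sum_integral_disjoint_le[OF I(1-3) Di]) (simp add: T_def)
    also have "integral {a..b} ?D < \<epsilon> / 2"
      using n integral_diff[OF kn Ti[of n]] by linarith
    also have "real n * (\<Sum>(s, t)\<in>I. t - s) \<le> real n * \<delta>"
      using I(4) by (intro mult_left_mono) auto
    also have "real n * \<delta> \<le> \<epsilon> / 2"
      using \<open>0 < \<epsilon>\<close> by (simp add: \<delta>_def field_simps)
    finally show "(\<Sum>(s, t)\<in>I. norm (integral {a..t} k - integral {a..s} k)) < \<epsilon>" by simp
  qed fact
qed

section \<open>Calculus of absolutely continuous functions\<close>

text \<open>The common source of the closure properties: the increments of sums, products, inverses
  and exponentials are dominated by those of their arguments. Operations with one argument take
  \<open>u\<close> and \<open>v\<close> equal.\<close>

lemma abs_cont_on_lipschitz: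
  assumes u: "abs_cont_on a b u" and v: "abs_cont_on a b v"
    and lip: "\<And>s t. \<lbrakk>s \<in> {a..b}; t \<in> {a..b}\<rbrakk>
               \<Longrightarrow> norm (w t - w s) \<le> C * (norm (u t - u s) + norm (v t - v s))"
  shows "abs_cont_on a b w"
  unfolding abs_cont_on_def
proof (intro allI impI)
  fix \<epsilon> :: real assume "0 < \<epsilon>"
  \<comment> \<open>The sign of \<open>C\<close> is arbitrary; \<open>D\<close> is a larger constant
    by which one may divide.\<close>
  define D where "D = \<bar>C\<bar> + 1"
  have D: "0 < D" "C \<le> D" by (auto simp: D_def)
  define \<eta> where "\<eta> = \<epsilon> / (2 * D)"
  have "0 < \<eta>" using \<open>0 < \<epsilon>\<close> D by (simp add: \<eta>_def)
  from u[unfolded abs_cont_on_def, rule_format, OF this] obtain \<delta>1 where "0 < \<delta>1"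
    and d1: "\<And>I. \<lbrakk>finite I; \<forall>(s, t)\<in>I. a \<le> s \<and> s \<le> t \<and> t \<le> b;
        disjoint_family_on (\<lambda>(s, t). {s<..<t}) I; (\<Sum>(s, t)\<in>I. t - s) < \<delta>1\<rbrakk>
        \<Longrightarrow> (\<Sum>(s, t)\<in>I. norm (u t - u s)) < \<eta>" by blast
  from v[unfolded abs_cont_on_def, rule_format, OF \<open>0 < \<eta>\<close>] obtain \<delta>2 where "0 < \<delta>2"
    and d2: "\<And>I. \<lbrakk>finite I; \<forall>(s, t)\<in>I. a \<le> s \<and> s \<le> t \<and> t \<le> b;
        disjoint_family_on (\<lambda>(s, t). {s<..<t}) I; (\<Sum>(s, t)\<in>I. t - s) < \<delta>2\<rbrakk>
        \<Longrightarrow> (\<Sum>(s, t)\<in>I. norm (v t - v s)) < \<eta>" by blast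
  show "\<exists>\<delta>>0. \<forall>I. finite I \<longrightarrow> (\<forall>(s, t)\<in>I. a \<le> s \<and> s \<le> t \<and> t \<le> b) \<longrightarrow>
    disjoint_family_on (\<lambda>(s, t). {s<..<t}) I \<longrightarrow> (\<Sum>(s, t)\<in>I. t - s) < \<delta> \<longrightarrow>
    (\<Sum>(s, t)\<in>I. norm (w t - w s)) < \<epsilon>"
  proof (intro exI[of _ "min \<delta>1 \<delta>2"] conjI allI impI)
    fix I :: "(real \<times> real) set"
    assume I: "finite I" "\<forall>(s, t)\<in>I. a \<le> s \<and> s \<le> t \<and> t \<le> b"
      "disjoint_family_on (\<lambda>(s, t). {s<..<t}) I" "(\<Sum>(s, t)\<in>I. t - s) < min \<delta>1 \<delta>2"
    have "(\<Sum>(s, t)\<in>I. norm (w t - w s))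
        \<le> (\<Sum>(s, t)\<in>I. D * (norm (u t - u s) + norm (v t - v s)))"
    proof (rule sum_mono, safe)
      fix s t assume "(s, t) \<in> I"
      then have "s \<in> {a..b}" "t \<in> {a..b}" using I(2) by auto
      then have "norm (w t - w s) \<le> C * (norm (u t - u s) + norm (v t - v s))" by (rule lip)
      also have "\<dots> \<le> D * (norm (u t - u s) + norm (v t - v s))"
        by (rule mult_right_mono[OF D(2)]) auto
      finally show "norm (w t - w s) \<le> D * (norm (u t - u s) + norm (v t - v s))" .
    qed
    also have "\<dots> = D * ((\<Sum>(s, t)\<in>I. norm (u t - u s)) + (\<Sum>(s, t)\<in>I. norm (v t - v s)))"
      by (simp add: split_def sum.distrib flip: sum_distrib_left)
    also have "\<dots> < D * (\<eta> + \<eta>)"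
      using I D by (intro mult_strict_left_mono add_strict_mono d1 d2) auto
    also have "\<dots> = \<epsilon>" using \<open>0 < \<epsilon>\<close> using D by (simp add: \<eta>_def)
    finally show "(\<Sum>(s, t)\<in>I. norm (w t - w s)) < \<epsilon>" .
  qed (use \<open>0 < \<delta>1\<close> \<open>0 < \<delta>2\<close> in auto)
qed

lemma abs_cont_on_imp_continuous_on:
  assumes "abs_cont_on a b u"
  shows "continuous_on {a..b} u"
  unfolding continuous_on_iff
proof (intro ballI allI impI)
  fix x \<epsilon> :: real assume x: "x \<in> {a..b}" and "0 < \<epsilon>"
  from assms[unfolded abs_cont_on_def, rule_format, OF \<open>0 < \<epsilon>\<close>] obtain \<delta> where "0 < \<delta>"
    and d: "\<And>I. \<lbrakk>finite I; \<forall>(s, t)\<in>I. a \<le> s \<and> s \<le> t \<and> t \<le> b;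
        disjoint_family_on (\<lambda>(s, t). {s<..<t}) I; (\<Sum>(s, t)\<in>I. t - s) < \<delta>\<rbrakk>
        \<Longrightarrow> (\<Sum>(s, t)\<in>I. norm (u t - u s)) < \<epsilon>" by blast
  have "dist (u y) (u x) < \<epsilon>" if "y \<in> {a..b}" "dist y x < \<delta>" for y
    using d[of "{(min x y, max x y)}"] x that
    by (cases "x \<le> y") (auto simp: disjoint_family_on_def dist_norm norm_minus_commute)
  with \<open>0 < \<delta>\<close> show "\<exists>d>0. \<forall>x'\<in>{a..b}. dist x' x < d \<longrightarrow> dist (u x') (u x) < \<epsilon>" by blast
qed

lemma abs_cont_on_subinterval:
  assumes "abs_cont_on a b u" "a \<le> c" "d \<le> b"
  shows "abs_cont_on c d u"
  unfolding abs_cont_on_def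
proof (intro allI impI)
  fix \<epsilon> :: real assume "0 < \<epsilon>"
  from assms(1)[unfolded abs_cont_on_def, rule_format, OF this] obtain \<delta> where "0 < \<delta>"
    and \<delta>: "\<And>I. \<lbrakk>finite I; \<forall>(s, t)\<in>I. a \<le> s \<and> s \<le> t \<and> t \<le> b;
        disjoint_family_on (\<lambda>(s, t). {s<..<t}) I; (\<Sum>(s, t)\<in>I. t - s) < \<delta>\<rbrakk>
        \<Longrightarrow> (\<Sum>(s, t)\<in>I. norm (u t - u s)) < \<epsilon>" by blast
  show "\<exists>\<delta>>0. \<forall>I. finite I \<longrightarrow> (\<forall>(s, t)\<in>I. c \<le> s \<and> s \<le> t \<and> t \<le> d) \<longrightarrow>
    disjoint_family_on (\<lambda>(s, t). {s<..<t}) I \<longrightarrow> (\<Sum>(s, t)\<in>I. t - s) < \<delta> \<longrightarrow>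
    (\<Sum>(s, t)\<in>I. norm (u t - u s)) < \<epsilon>"
  proof (intro exI[of _ \<delta>] conjI allI impI \<delta>)
    fix I :: "(real \<times> real) set" assume I: "\<forall>(s, t)\<in>I. c \<le> s \<and> s \<le> t \<and> t \<le> d"
    show "\<forall>(s, t)\<in>I. a \<le> s \<and> s \<le> t \<and> t \<le> b"
    proof safe
      fix s t assume "(s, t) \<in> I"
      then have "c \<le> s \<and> s \<le> t \<and> t \<le> d" using I by blast
      with assms(2,3) show "a \<le> s" "s \<le> t" "t \<le> b" by auto
    qed
  qed fact
qed

lemma abs_cont_on_cong:
  assumes "\<And>x. x \<in> {a..b} \<Longrightarrow> u x = v x" "abs_cont_on a b u"
  shows "abs_cont_on a b v"
  by (rule abs_cont_on_lipschitz[OF assms(2,2), of _ 1]) (simp add: assms(1))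

lemma AE_lebesgue_mono:
  assumes "AE x\<in>S in lebesgue. P x" and "\<And>x. \<lbrakk>x \<in> S; P x\<rbrakk> \<Longrightarrow> Q x"
  shows "AE x\<in>S in lebesgue. Q x"
  using assms(1) by (rule eventually_mono) (use assms(2) in blast)

lemma AE_lebesgue_mono2:
  assumes "AE x\<in>S in lebesgue. P1 x" "AE x\<in>S in lebesgue. P2 x"
    and "\<And>x. \<lbrakk>x \<in> S; P1 x; P2 x\<rbrakk> \<Longrightarrow> Q x"
  shows "AE x\<in>S in lebesgue. Q x"
  using eventually_conj[OF assms(1,2)] by (rule eventually_mono) (use assms(3) in blast)

text \<open>The derivative is carried along as data determined up to a null set, so that the rules
  of calculus can compute it. Its integrability is assumed separately, where a gauge integral is to
  be read as a Lebesgue integral.\<close>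

definition ac_deriv :: "real \<Rightarrow> real \<Rightarrow> (real \<Rightarrow> complex) \<Rightarrow> (real \<Rightarrow> complex) \<Rightarrow> bool" where
  "ac_deriv a b u k \<longleftrightarrow> abs_cont_on a b u \<and>
     (AE x\<in>{a..b} in lebesgue. (u has_vector_derivative k x) (at x within {a..b}))"

lemma ac_deriv_abs_cont: "ac_deriv a b u k \<Longrightarrow> abs_cont_on a b u"
  and ac_deriv_AE: "ac_deriv a b u k \<Longrightarrow>
    AE x\<in>{a..b} in lebesgue. (u has_vector_derivative k x) (at x within {a..b})"
  by (simp_all add: ac_deriv_def)

lemma ac_deriv_continuous_on: "ac_deriv a b u k \<Longrightarrow> continuous_on {a..b} u"
  by (simp add: ac_deriv_def abs_cont_on_imp_continuous_on)

lemma ac_deriv_cong: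
  assumes "ac_deriv a b u k" "\<And>x. x \<in> {a..b} \<Longrightarrow> u x = v x"
  shows "ac_deriv a b v k"
  unfolding ac_deriv_def
proof
  show "abs_cont_on a b v"
    using abs_cont_on_cong[OF assms(2)] assms(1) by (simp add: ac_deriv_def)
  show "AE x\<in>{a..b} in lebesgue. (v has_vector_derivative k x) (at x within {a..b})"
    using assms(1)[unfolded ac_deriv_def, THEN conjunct2]
    by (rule AE_lebesgue_mono) (metis has_vector_derivative_transform assms(2))
qed

lemma ac_deriv_cong_AE:
  assumes "ac_deriv a b u k" "AE x\<in>{a..b} in lebesgue. k x = l x"
  shows "ac_deriv a b u l"
  unfolding ac_deriv_def
  by (intro conjI ac_deriv_abs_cont[OF assms(1)] AE_lebesgue_mono2[OF ac_deriv_AE[OF assms(1)] assms(2)]) simp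

lemma ac_deriv_const: "ac_deriv a b (\<lambda>_. c) (\<lambda>_. 0)"
  by (auto simp: ac_deriv_def abs_cont_on_def split_def intro!: exI[of _ "1::real"])

lemma ac_deriv_add:
  assumes "ac_deriv a b u k" "ac_deriv a b v l"
  shows "ac_deriv a b (\<lambda>x. u x + v x) (\<lambda>x. k x + l x)"
  unfolding ac_deriv_def
proof
  show "abs_cont_on a b (\<lambda>x. u x + v x)"
  proof (rule abs_cont_on_lipschitz[OF assms[THEN ac_deriv_abs_cont], of _ 1])
    fix s t
    show "norm (u t + v t - (u s + v s)) \<le> 1 * (norm (u t - u s) + norm (v t - v s))"
      using norm_triangle_ineq[of "u t - u s" "v t - v s"] by (simp add: add_diff_add)
  qed
  show "AE x\<in>{a..b} in lebesgue. ((\<lambda>x. u x + v x) has_vector_derivative k x + l x) (at x within {a..b})"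
    by (rule AE_lebesgue_mono2[OF assms[THEN ac_deriv_AE]]) (rule has_vector_derivative_add)
qed

text \<open>Both factors are bounded on the compact interval, which makes multiplication Lipschitz
  along them.\<close>

lemma ac_deriv_mult:
  assumes u: "ac_deriv a b u k" and v: "ac_deriv a b v l"
  shows "ac_deriv a b (\<lambda>x. u x * v x) (\<lambda>x. u x * l x + k x * v x)"
  unfolding ac_deriv_def
proof
  have "bounded (u ` {a..b})" "bounded (v ` {a..b})"
    using u v by (auto intro!: compact_imp_bounded compact_continuous_image ac_deriv_continuous_on)
  then obtain Mu Mv where Mu: "\<And>x. x \<in> {a..b} \<Longrightarrow> norm (u x) \<le> Mu"
    and Mv: "\<And>x. x \<in> {a..b} \<Longrightarrow> norm (v x) \<le> Mv"
    unfolding bounded_iff by (metis image_eqI)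
  show "abs_cont_on a b (\<lambda>x. u x * v x)"
  proof (rule abs_cont_on_lipschitz[of a b u v _ "max Mu Mv"])
    fix s t assume st: "s \<in> {a..b}" "t \<in> {a..b}"
    have "u t * v t - u s * v s = u t * (v t - v s) + v s * (u t - u s)"
      by (simp add: algebra_simps)
    then have "norm (u t * v t - u s * v s) \<le> norm (u t) * norm (v t - v s) + norm (v s) * norm (u t - u s)"
      by (metis norm_mult norm_triangle_ineq)
    also have "\<dots> \<le> max Mu Mv * norm (v t - v s) + max Mu Mv * norm (u t - u s)"
      using Mu[OF st(2)] Mv[OF st(1)] by (intro add_mono mult_right_mono) auto
    finally show "norm (u t * v t - u s * v s) \<le> max Mu Mv * (norm (u t - u s) + norm (v t - v s))"
      by (simp add: algebra_simps)
  qed (use u v in \<open>auto simp: ac_deriv_def\<close>)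
  show "AE x\<in>{a..b} in lebesgue.
      ((\<lambda>x. u x * v x) has_vector_derivative u x * l x + k x * v x) (at x within {a..b})"
    by (rule AE_lebesgue_mono2[OF ac_deriv_AE[OF u] ac_deriv_AE[OF v]]) (rule has_vector_derivative_mult)
qed

lemma ac_deriv_cmult:
  assumes "ac_deriv a b u k"
  shows "ac_deriv a b (\<lambda>x. c * u x) (\<lambda>x. c * k x)"
  using ac_deriv_mult[OF ac_deriv_const assms, of c] by simp

lemma ac_deriv_diff:
  assumes "ac_deriv a b u k" "ac_deriv a b v l"
  shows "ac_deriv a b (\<lambda>x. u x - v x) (\<lambda>x. k x - l x)"
  using ac_deriv_add[OF assms(1) ac_deriv_cmult[OF assms(2), of "-1"]] by simp

lemma ac_deriv_inverse:
  assumes u: "ac_deriv a b u k" and nz: "\<And>x. x \<in> {a..b} \<Longrightarrow> u x \<noteq> 0"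
  shows "ac_deriv a b (\<lambda>x. inverse (u x)) (\<lambda>x. - k x / (u x)\<^sup>2)"
  unfolding ac_deriv_def
proof
  have "continuous_on {a..b} (\<lambda>x. inverse (u x))"
    using u nz by (intro continuous_intros ac_deriv_continuous_on) auto
  then have "bounded ((\<lambda>x. inverse (u x)) ` {a..b})"
    by (intro compact_imp_bounded compact_continuous_image) auto
  then obtain M where M: "\<And>x. x \<in> {a..b} \<Longrightarrow> norm (inverse (u x)) \<le> M"
    unfolding bounded_iff by (metis image_eqI)
  show "abs_cont_on a b (\<lambda>x. inverse (u x))"
  proof (rule abs_cont_on_lipschitz[of a b u u _ "M * M"])
    fix s t assume st: "s \<in> {a..b}" "t \<in> {a..b}"
    then have "inverse (u t) - inverse (u s) = - (inverse (u t) * (u t - u s) * inverse (u s))"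
      using nz by (intro inverse_diff_inverse) auto
    then have "norm (inverse (u t) - inverse (u s))
        = norm (inverse (u t)) * norm (inverse (u s)) * norm (u t - u s)"
      by (simp add: norm_mult)
    also have "\<dots> \<le> (M * M) * (norm (u t - u s) + norm (u t - u s))"
      using M[OF st(1)] M[OF st(2)] by (intro mult_mono) (auto intro: order_trans[OF norm_ge_zero])
    finally show "norm (inverse (u t) - inverse (u s)) \<le> (M * M) * (norm (u t - u s) + norm (u t - u s))" .
  qed (use u in \<open>auto simp: ac_deriv_def\<close>)
  show "AE x\<in>{a..b} in lebesgue.
      ((\<lambda>x. inverse (u x)) has_vector_derivative - k x / (u x)\<^sup>2) (at x within {a..b})"
    using u[unfolded ac_deriv_def, THEN conjunct2]
  proof (rule AE_lebesgue_mono)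
    fix x assume x: "x \<in> {a..b}" "(u has_vector_derivative k x) (at x within {a..b})"
    have "(inverse has_field_derivative - inverse (u x ^ 2)) (at (u x))"
      using DERIV_inverse[OF nz[OF x(1)]] by (simp add: numeral_2_eq_2)
    from field_vector_diff_chain_within[OF x(2) has_field_derivative_at_within[OF this]]
    show "((\<lambda>x. inverse (u x)) has_vector_derivative - k x / (u x)\<^sup>2) (at x within {a..b})"
      by (simp add: o_def divide_inverse)
  qed
qed

lemma ac_deriv_exp:
  assumes u: "ac_deriv a b u k"
  shows "ac_deriv a b (\<lambda>x. exp (u x)) (\<lambda>x. k x * exp (u x))"
  unfolding ac_deriv_def
proof
  have "bounded (u ` {a..b})"
    using u by (auto intro!: compact_imp_bounded compact_continuous_image ac_deriv_continuous_on)
  then obtain M where M: "\<And>x. x \<in> {a..b} \<Longrightarrow> norm (u x) \<le> M"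
    unfolding bounded_iff by (metis image_eqI)
  show "abs_cont_on a b (\<lambda>x. exp (u x))"
  proof (rule abs_cont_on_lipschitz[of a b u u _ "exp M"])
    fix s t assume st: "s \<in> {a..b}" "t \<in> {a..b}"
    \<comment> \<open>Mean value inequality on the disc \<open>cball 0 M\<close>, which is convex
      and contains all values of \<open>u\<close>.\<close>
    have "norm (exp (u t) - exp (u s)) \<le> exp M * norm (u t - u s)"
    proof (rule field_differentiable_bound[of "cball 0 M" exp exp])
      show "norm (exp z) \<le> exp M" if "z \<in> cball 0 M" for z :: complex
        using norm_exp[of z] that by (auto intro: order_trans)
    qed (use M st in \<open>auto intro: has_field_derivative_at_within DERIV_exp\<close>)
    also have "\<dots> \<le> exp M * (norm (u t - u s) + norm (u t - u s))" by simp
    finally show "norm (exp (u t) - exp (u s)) \<le> exp M * (norm (u t - u s) + norm (u t - u s))" .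
  qed (use u in \<open>auto simp: ac_deriv_def\<close>)
  show "AE x\<in>{a..b} in lebesgue.
      ((\<lambda>x. exp (u x)) has_vector_derivative k x * exp (u x)) (at x within {a..b})"
    using u[unfolded ac_deriv_def, THEN conjunct2]
  proof (rule AE_lebesgue_mono)
    fix x assume x: "(u has_vector_derivative k x) (at x within {a..b})"
    from field_vector_diff_chain_within[OF x has_field_derivative_at_within[OF DERIV_exp]]
    show "((\<lambda>x. exp (u x)) has_vector_derivative k x * exp (u x)) (at x within {a..b})"
      by (simp add: o_def)
  qed
qed

lemma ac_deriv_subinterval:
  assumes "ac_deriv a b u k" "a \<le> c" "d \<le> b"
  shows "ac_deriv c d u k"
  unfolding ac_deriv_def
proof
  show "abs_cont_on c d u"
    using assms abs_cont_on_subinterval by (auto simp: ac_deriv_def)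
  have "AE x\<in>{a..b} in lebesgue. (u has_vector_derivative k x) (at x within {a..b})"
    using assms(1) by (simp add: ac_deriv_def)
  then show "AE x\<in>{c..d} in lebesgue. (u has_vector_derivative k x) (at x within {c..d})"
  proof (rule eventually_mono, intro impI)
    fix x assume x: "x \<in> {a..b} \<longrightarrow> (u has_vector_derivative k x) (at x within {a..b})" "x \<in> {c..d}"
    have sub: "{c..d} \<subseteq> {a..b}" using assms(2,3) by auto
    then have "(u has_vector_derivative k x) (at x within {a..b})" using x by blast
    then show "(u has_vector_derivative k x) (at x within {c..d})"
      using sub by (rule has_vector_derivative_within_subset)
  qed
qed

lemma ac_deriv_has_integral:
  assumes "ac_deriv a b u k" "a \<le> s" "s \<le> t" "t \<le> b"
  shows "(k has_integral (u t - u s)) {s..t}"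
  using assms(3) ac_deriv_subinterval[OF assms(1,2,4)]
  by (intro abs_cont_on_has_integral ac_deriv_abs_cont ac_deriv_AE)

section \<open>Oriented integrals from the base point\<close>

lemma int_from_eq_integral:
  assumes k: "k absolutely_integrable_on {a..b}" and "x0 \<in> {a..b}" "x \<in> {a..b}"
  shows "int_from x0 k x = (if x0 \<le> x then integral {x0..x} k else - integral {x..x0} k)"
proof -
  have *: "(LINT t:{s<..<t}|lebesgue. k t) = integral {s..t} k"
    if "a \<le> s" "t \<le> b" for s t
  proof -
    have "k absolutely_integrable_on {s<..<t}"
      by (rule set_integrable_subset[OF k]) (use that in auto)
    then show ?thesis
      by (simp add: set_lebesgue_integral_eq_integral(2) integral_open_interval_real)
  qed
  show ?thesis
    using assms by (auto simp: int_from_def interval_lebesgue_integral_def *)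
qed

text \<open>A single formula for both orientations, which keeps additivity and differentiation free
  of a case distinction on the side of \<open>x0\<close>.\<close>

lemma int_from_eq_diff:
  assumes k: "k absolutely_integrable_on {a..b}" and x0: "x0 \<in> {a..b}" and x: "x \<in> {a..b}"
  shows "int_from x0 k x = integral {a..x} k - integral {a..x0} k"
proof -
  have sub: "k integrable_on {a..t}" if "t \<le> b" for t
    by (rule integrable_on_subinterval[OF set_lebesgue_integral_eq_integral(1)[OF k]]) (use that in auto)
  have *: "integral {a..s} k + integral {s..t} k = integral {a..t} k" if "a \<le> s" "s \<le> t" "t \<le> b" for s t
    using Henstock_Kurzweil_Integration.integral_combine[OF that(1,2) sub[OF that(3)]] .
  show ?thesis
    using *[of x0 x] *[of x x0] x0 x unfolding int_from_eq_integral[OF k x0 x]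
    by (auto simp: algebra_simps)
qed

text \<open>Moving the base point from \<open>a\<close> to \<open>x0\<close> only subtracts a
  constant, so the differentiation theorem carries over.\<close>

lemma ac_deriv_int_from:
  assumes k: "k absolutely_integrable_on {a..b}" and x0: "x0 \<in> {a..b}"
  shows "ac_deriv a b (int_from x0 k) k"
proof -
  have "ac_deriv a b (\<lambda>x. integral {a..x} k) k"
    unfolding ac_deriv_def
    by (intro conjI abs_cont_on_integral[OF k] integral_has_vector_derivative_ae
        set_lebesgue_integral_eq_integral(1)[OF k])
  from ac_deriv_diff[OF this ac_deriv_const[of a b "integral {a..x0} k"]]
  show ?thesis
    by (intro ac_deriv_cong[where v = "int_from x0 k"]) (auto simp: int_from_eq_diff[OF k x0])
qed

lemma ac_deriv_eq_int_from:
  assumes u: "ac_deriv a b u k" and k: "k absolutely_integrable_on {a..b}"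
    and x: "x0 \<in> {a..b}" "x \<in> {a..b}"
  shows "u x = u x0 + int_from x0 k x"
proof (cases "x0 \<le> x")
  case True
  then have "integral {x0..x} k = u x - u x0"
    using x by (intro integral_unique ac_deriv_has_integral[OF u]) auto
  with True show ?thesis by (simp add: int_from_eq_integral[OF k x])
next
  case False
  then have "integral {x..x0} k = u x0 - u x"
    using x by (intro integral_unique ac_deriv_has_integral[OF u]) auto
  with False show ?thesis by (simp add: int_from_eq_integral[OF k x])
qed

text \<open>This is where absolute continuity is indispensable: Cantor's function has derivative
  zero almost everywhere without being constant.\<close>

lemma ac_deriv_zero_imp_eq:
  assumes u: "ac_deriv a b u (\<lambda>_. 0)" and x: "x0 \<in> {a..b}" "x \<in> {a..b}"
  shows "u x = u x0"
  using ac_deriv_eq_int_from[OF u _ x] by (simp add: int_from_eq_integral[OF _ x])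

lemma int_from_self: "int_from x0 k x0 = 0"
  by (simp add: int_from_def interval_lebesgue_integral_def set_lebesgue_integral_def)

lemma int_from_cong:
  assumes "x0 \<in> {a..b}" "x \<in> {a..b}" "\<And>s. s \<in> {a..b} \<Longrightarrow> k s = l s"
  shows "int_from x0 k x = int_from x0 l x"
  unfolding int_from_def interval_lebesgue_integral_def
  by (intro if_cong refl arg_cong[where f=uminus] set_lebesgue_integral_cong) (use assms in auto)

text \<open>True without integrability, because a nonintegrable function has Lebesgue integral 0 and
  a nonzero factor does not change integrability. Scaling of the Volterra operators is unconditional
  for this reason.\<close>

lemma int_from_cmult: "int_from x0 (\<lambda>s. c * k s) x = c * int_from x0 k x"
  by (simp add: int_from_def)

lemma int_from_add:
  assumes x: "x0 \<in> {a..b}" "x \<in> {a..b}"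
    and k: "k absolutely_integrable_on {a..b}" and l: "l absolutely_integrable_on {a..b}"
  shows "int_from x0 (\<lambda>s. k s + l s) x = int_from x0 k x + int_from x0 l x"
proof -
  have kl: "(\<lambda>s. k s + l s) absolutely_integrable_on {a..b}"
    using k l by (rule set_integral_add)
  have sub: "h integrable_on {a..t}" if "t \<le> b" "h absolutely_integrable_on {a..b}" for t and h :: "real \<Rightarrow> complex"
    by (rule integrable_on_subinterval[OF set_lebesgue_integral_eq_integral(1)[OF that(2)]]) (use that in auto)
  show ?thesis
    using x by (simp add: int_from_eq_diff[OF _ x] k l kl integral_add sub)
qed

lemma absolutely_integrable_mult_continuous:
  fixes k w :: "real \<Rightarrow> complex"
  assumes k: "k absolutely_integrable_on {a..b}" and w: "continuous_on {a..b} w"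
  shows "(\<lambda>x. k x * w x) absolutely_integrable_on {a..b}"
proof -
  have "(\<lambda>x. w x * k x) absolutely_integrable_on {a..b}"
  proof (rule absolutely_integrable_bounded_measurable_product[OF bilinear_times])
    show "w \<in> borel_measurable (lebesgue_on {a..b})"
      using w by (rule continuous_imp_measurable_on_sets_lebesgue) auto
    show "bounded (w ` {a..b})"
      using w by (intro compact_imp_bounded compact_continuous_image) auto
  qed (use k in auto)
  then show ?thesis by (simp add: mult.commute)
qed

text \<open>Let \<open>E = exp (K * |G|)\<close>, where \<open>G\<close> is the oriented primitive
  of \<open>h\<close>. Up to sign \<open>h * E\<close> is the derivative of \<open>E / K\<close>, so
  each integration against \<open>h\<close> in the weighted norm gains a factor
  \<open>1 / K\<close>. This gain is the source of the contraction.\<close>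

lemma norm_int_from_le_exp:
  fixes h :: "real \<Rightarrow> real"
  assumes x0: "x0 \<in> {a..b}" and h: "h absolutely_integrable_on {a..b}"
    and h0: "\<And>s. s \<in> {a..b} \<Longrightarrow> 0 \<le> h s"
    and K: "0 < K" and k: "k absolutely_integrable_on {a..b}" and M: "0 \<le> M"
    and bound: "\<And>s. s \<in> {a..b} \<Longrightarrow>
      norm (k s) \<le> M * (h s * exp (K * norm (int_from x0 (\<lambda>s. of_real (h s)) s)))"
    and x: "x \<in> {a..b}"
  shows "norm (int_from x0 k x) \<le> M / K * exp (K * norm (int_from x0 (\<lambda>s. of_real (h s)) x))"
proof -
  let ?h = "\<lambda>s. complex_of_real (h s)"
  let ?H = "int_from x0 ?h"
  have hc: "?h absolutely_integrable_on {a..b}"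
    using absolutely_integrable_linear[OF h bounded_linear_of_real] by (simp add: o_def)
  have hi: "h integrable_on {s..t}" if "a \<le> s" "t \<le> b" for s t
    by (rule integrable_on_subinterval[OF set_lebesgue_integral_eq_integral(1)[OF h]]) (use that in auto)
  \<comment> \<open>The real version of the complex valued \<open>?H\<close>, for which signs make
    sense: nonnegative to the right of \<open>x0\<close> and nonpositive to the left.\<close>
  define G where "G s = (if x0 \<le> s then integral {x0..s} h else - integral {s..x0} h)" for s
  have HG: "?H s = of_real (G s)" if "s \<in> {a..b}" for s
  proof -
    have "integral {s..t} ?h = of_real (integral {s..t} h)" if "a \<le> s" "t \<le> b" for s t
      using has_integral_of_real[OF integrable_integral[OF hi[OF that]]] by (rule integral_unique)
    then show ?thesis
      using that x0 by (auto simp: G_def int_from_eq_integral[OF hc x0 that])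
  qed
  have Gpos: "0 \<le> G s" if "x0 \<le> s" "s \<le> b" for s
    using that x0 h0 hi by (auto simp: G_def intro!: integral_nonneg)
  have Gneg: "G s \<le> 0" if "s \<le> x0" "a \<le> s" for s
    using that x0 h0 hi by (cases "s = x0") (auto simp: G_def intro!: integral_nonneg)
  have exp_int: "((\<lambda>s. c * h s * exp (c * G s)) has_integral (exp (c * G t) - exp (c * G s))) {s..t}"
    if "a \<le> s" "s \<le> t" "t \<le> b" for c s t
  proof -
    have "ac_deriv a b (\<lambda>s. exp (of_real c * ?H s)) (\<lambda>s. (of_real c * ?h s) * exp (of_real c * ?H s))"
      by (intro ac_deriv_exp ac_deriv_cmult ac_deriv_int_from hc x0)
    from ac_deriv_has_integral[OF this that]
    have "((\<lambda>s. (of_real c * ?h s) * exp (of_real c * ?H s)) has_integral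
        (exp (of_real c * ?H t) - exp (of_real c * ?H s))) {s..t}" .
    moreover have "exp (of_real c * ?H r) = of_real (exp (c * G r))" if "r \<in> {a..b}" for r
      unfolding HG[OF that] by (simp add: exp_of_real flip: of_real_mult)
    ultimately have "((\<lambda>s. complex_of_real (c * h s * exp (c * G s))) has_integral
        of_real (exp (c * G t) - exp (c * G s))) {s..t}"
      using that by (subst has_integral_cong[of _ _ "\<lambda>s. (of_real c * ?h s) * exp (of_real c * ?H s)"]) auto
    from has_integral_Re[OF this] show ?thesis by (simp only: Re_complex_of_real)
  qed
  have ki: "k integrable_on {s..t}" if "a \<le> s" "t \<le> b" for s t
    by (rule integrable_on_subinterval[OF set_lebesgue_integral_eq_integral(1)[OF k]]) (use that in auto)
  \<comment> \<open>The constant \<open>c\<close> is \<open>K\<close> to the right of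
    \<open>x0\<close> and \<open>- K\<close> to the left, which removes the absolute value of
    \<open>G\<close> from the exponent.\<close>
  have est: "norm (integral {s..t} k) \<le> (M / c) * (exp (c * G t) - exp (c * G s))"
    if st: "a \<le> s" "s \<le> t" "t \<le> b" and c: "c \<noteq> 0" "\<And>r. r \<in> {s..t} \<Longrightarrow> K * \<bar>G r\<bar> = c * G r" for c s t
  proof -
    have int: "((\<lambda>r. M / c * (c * h r * exp (c * G r))) has_integral (M / c * (exp (c * G t) - exp (c * G s)))) {s..t}"
      by (rule has_integral_mult_right[OF exp_int[OF st]])
    have "norm (integral {s..t} k) \<le> integral {s..t} (\<lambda>r. M / c * (c * h r * exp (c * G r)))"
    proof (rule integral_norm_bound_integral)
      fix r assume r: "r \<in> {s..t}"
      then have "r \<in> {a..b}" using st by auto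
      from bound[OF this] HG[OF this] c(2)[OF r] c(1)
      show "norm (k r) \<le> M / c * (c * h r * exp (c * G r))" by (simp add: mult.assoc)
    qed (use ki st int in \<open>auto simp: has_integral_integrable_integral\<close>)
    then show ?thesis using integral_unique[OF int] by simp
  qed
  have G0: "G x0 = 0" by (simp add: G_def)
  show ?thesis
  proof (cases "x0 \<le> x")
    case True
    have "norm (int_from x0 k x) = norm (integral {x0..x} k)"
      using True by (simp add: int_from_eq_integral[OF k x0 x])
    also have "\<dots> \<le> M / K * (exp (K * G x) - exp (K * G x0))"
      by (rule est) (use True x x0 K Gpos in auto)
    also have "\<dots> \<le> M / K * exp (K * G x)"
      using M K by (intro mult_left_mono) auto
    finally show ?thesis using HG[OF x] Gpos[OF True] x by simp
  next
    case False
    have "norm (int_from x0 k x) = norm (integral {x..x0} k)"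
      using False by (simp add: int_from_eq_integral[OF k x0 x])
    also have "\<dots> \<le> M / (- K) * (exp (- K * G x0) - exp (- K * G x))"
      by (rule est) (use False x x0 K Gneg in auto)
    also have "\<dots> = M / K * (exp (- K * G x) - 1)"
      using K by (simp add: G0 field_simps)
    also have "\<dots> \<le> M / K * exp (- K * G x)"
      using M K by (intro mult_left_mono) auto
    finally show ?thesis using HG[OF x] Gneg[of x] False x by simp
  qed
qed

section \<open>Volterra operators\<close>

definition coupling :: "real \<Rightarrow> (real \<Rightarrow> complex) \<Rightarrow> (real \<Rightarrow> complex) \<Rightarrow>
    (real \<Rightarrow> complex) \<Rightarrow> (real \<Rightarrow> complex) \<Rightarrow> real \<Rightarrow> complex" where
  "coupling x0 d1 d2 X Y = int_from x0 (\<lambda>s. d1 s * X s + d2 s * Y s)"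

text \<open>One component of the operator \<open>T\<close>; different coefficient triples give the
  \<open>X\<close> and the \<open>Y\<close> component. The factor of \<open>c3\<close> is the
  primitive that plays the part of \<open>Z\<close> in the recursion.\<close>

definition volterra :: "real \<Rightarrow> (real \<Rightarrow> complex) \<Rightarrow> (real \<Rightarrow> complex) \<Rightarrow>
    (real \<Rightarrow> complex) \<Rightarrow> (real \<Rightarrow> complex) \<Rightarrow> (real \<Rightarrow> complex) \<Rightarrow>
    (real \<Rightarrow> complex) \<Rightarrow> (real \<Rightarrow> complex) \<Rightarrow> real \<Rightarrow> complex" where
  "volterra x0 d1 d2 c1 c2 c3 X Y =
     int_from x0 (\<lambda>s. c1 s * X s + c2 s * Y s + c3 s * coupling x0 d1 d2 X Y s)"

lemma int_from_lincomb:
  assumes x: "x0 \<in> {a..b}" "x \<in> {a..b}"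
    and k: "k absolutely_integrable_on {a..b}" and l: "l absolutely_integrable_on {a..b}"
  shows "int_from x0 (\<lambda>s. c * k s + d * l s) x = c * int_from x0 k x + d * int_from x0 l x"
  using int_from_add[OF x, of "\<lambda>s. c * k s" "\<lambda>s. d * l s"] k l
  by (simp add: int_from_cmult)

lemma absolutely_integrable_lincomb3:
  fixes c1 c2 c3 X Y Z :: "real \<Rightarrow> complex"
  assumes "c1 absolutely_integrable_on {a..b}" "c2 absolutely_integrable_on {a..b}"
    "c3 absolutely_integrable_on {a..b}"
    and "continuous_on {a..b} X" "continuous_on {a..b} Y" "continuous_on {a..b} Z"
  shows "(\<lambda>s. c1 s * X s + c2 s * Y s + c3 s * Z s) absolutely_integrable_on {a..b}"
  by (intro set_integral_add absolutely_integrable_mult_continuous assms)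

lemma absolutely_integrable_lincomb2:
  fixes c1 c2 X Y :: "real \<Rightarrow> complex"
  assumes "c1 absolutely_integrable_on {a..b}" "c2 absolutely_integrable_on {a..b}"
    and "continuous_on {a..b} X" "continuous_on {a..b} Y"
  shows "(\<lambda>s. c1 s * X s + c2 s * Y s) absolutely_integrable_on {a..b}"
  by (intro set_integral_add absolutely_integrable_mult_continuous assms)

lemma volterra_cmult:
  "volterra x0 d1 d2 c1 c2 c3 (\<lambda>s. c * X s) (\<lambda>s. c * Y s) x = c * volterra x0 d1 d2 c1 c2 c3 X Y x"
proof -
  have "coupling x0 d1 d2 (\<lambda>s. c * X s) (\<lambda>s. c * Y s) = (\<lambda>s. c * coupling x0 d1 d2 X Y s)"
    unfolding coupling_def by (subst int_from_cmult[symmetric]) (simp add: algebra_simps)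
  then show ?thesis
    unfolding volterra_def by (subst int_from_cmult[symmetric]) (simp add: algebra_simps)
qed

text \<open>The convergence theory rests on integrability of the eight coefficients alone; the signs
  and quotients of the concrete system enter through an interpretation.\<close>

locale volterra_system =
  fixes a b x0 :: real and A1 A2 A3 B1 B2 B3 d1 d2 :: "real \<Rightarrow> complex"
  assumes x0: "x0 \<in> {a..b}"
    and A: "A1 absolutely_integrable_on {a..b}" "A2 absolutely_integrable_on {a..b}"
      "A3 absolutely_integrable_on {a..b}"
    and B: "B1 absolutely_integrable_on {a..b}" "B2 absolutely_integrable_on {a..b}"
      "B3 absolutely_integrable_on {a..b}"
    and d: "d1 absolutely_integrable_on {a..b}" "d2 absolutely_integrable_on {a..b}"
begin

abbreviation "Z \<equiv> coupling x0 d1 d2"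
abbreviation "TX \<equiv> volterra x0 d1 d2 A1 A2 A3"
abbreviation "TY \<equiv> volterra x0 d1 d2 B1 B2 B3"

text \<open>One function dominates the inner coefficients and both outer triples, so that a single
  weight serves the inner integral and both components.\<close>

definition h :: "real \<Rightarrow> real" where
  "h s = (norm (A1 s) + norm (A2 s) + norm (A3 s)) + (norm (B1 s) + norm (B2 s) + norm (B3 s))
         + (norm (d1 s) + norm (d2 s))"

text \<open>The modulus makes the exponent nonnegative on both sides of \<open>x0\<close>.\<close>

definition H :: "real \<Rightarrow> real" where
  "H x = norm (int_from x0 (\<lambda>s. of_real (h s)) x)"

lemma h_integrable: "h absolutely_integrable_on {a..b}"
  unfolding h_def using A B d
  by (intro set_integral_add) (auto dest: absolutely_integrable_norm simp: o_def)

lemma ac_deriv_coupling: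
  assumes "continuous_on {a..b} X" "continuous_on {a..b} Y"
  shows "ac_deriv a b (Z X Y) (\<lambda>s. d1 s * X s + d2 s * Y s)"
  unfolding coupling_def
  by (intro ac_deriv_int_from x0 absolutely_integrable_lincomb2 d assms)

lemma coupling_continuous:
  assumes "continuous_on {a..b} X" "continuous_on {a..b} Y"
  shows "continuous_on {a..b} (Z X Y)"
  by (rule ac_deriv_continuous_on[OF ac_deriv_coupling[OF assms]])

lemma ac_deriv_volterra:
  assumes "c1 absolutely_integrable_on {a..b}" "c2 absolutely_integrable_on {a..b}"
    "c3 absolutely_integrable_on {a..b}" "continuous_on {a..b} X" "continuous_on {a..b} Y"
  shows "ac_deriv a b (volterra x0 d1 d2 c1 c2 c3 X Y) (\<lambda>s. c1 s * X s + c2 s * Y s + c3 s * Z X Y s)"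
  unfolding volterra_def
  by (intro ac_deriv_int_from x0 absolutely_integrable_lincomb3 coupling_continuous assms)

lemma volterra_continuous:
  assumes "c1 absolutely_integrable_on {a..b}" "c2 absolutely_integrable_on {a..b}"
    "c3 absolutely_integrable_on {a..b}" "continuous_on {a..b} X" "continuous_on {a..b} Y"
  shows "continuous_on {a..b} (volterra x0 d1 d2 c1 c2 c3 X Y)"
  by (rule ac_deriv_continuous_on[OF ac_deriv_volterra[OF assms]])

lemma coupling_lincomb:
  assumes "x \<in> {a..b}" "continuous_on {a..b} X" "continuous_on {a..b} Y"
    "continuous_on {a..b} X'" "continuous_on {a..b} Y'"
  shows "Z (\<lambda>s. c * X s + e * X' s) (\<lambda>s. c * Y s + e * Y' s) x = c * Z X Y x + e * Z X' Y' x"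
proof -
  have "Z (\<lambda>s. c * X s + e * X' s) (\<lambda>s. c * Y s + e * Y' s) x
    = int_from x0 (\<lambda>s. c * (d1 s * X s + d2 s * Y s) + e * (d1 s * X' s + d2 s * Y' s)) x"
    by (simp add: coupling_def algebra_simps)
  also have "\<dots> = c * Z X Y x + e * Z X' Y' x"
    unfolding coupling_def by (rule int_from_lincomb[OF x0 assms(1)]) (intro absolutely_integrable_lincomb2 d assms)+
  finally show ?thesis .
qed

lemma volterra_lincomb:
  assumes c: "c1 absolutely_integrable_on {a..b}" "c2 absolutely_integrable_on {a..b}"
    "c3 absolutely_integrable_on {a..b}" and x: "x \<in> {a..b}"
    and XY: "continuous_on {a..b} X" "continuous_on {a..b} Y"
    "continuous_on {a..b} X'" "continuous_on {a..b} Y'"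
  shows "volterra x0 d1 d2 c1 c2 c3 (\<lambda>s. c * X s + e * X' s) (\<lambda>s. c * Y s + e * Y' s) x
    = c * volterra x0 d1 d2 c1 c2 c3 X Y x + e * volterra x0 d1 d2 c1 c2 c3 X' Y' x"
proof -
  have "volterra x0 d1 d2 c1 c2 c3 (\<lambda>s. c * X s + e * X' s) (\<lambda>s. c * Y s + e * Y' s) x
    = int_from x0 (\<lambda>s. c * (c1 s * X s + c2 s * Y s + c3 s * Z X Y s)
        + e * (c1 s * X' s + c2 s * Y' s + c3 s * Z X' Y' s)) x"
    unfolding volterra_def
  proof (rule int_from_cong[OF x0 x])
    fix s assume "s \<in> {a..b}"
    from coupling_lincomb[OF this XY]
    show "c1 s * (c * X s + e * X' s) + c2 s * (c * Y s + e * Y' s) +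
          c3 s * Z (\<lambda>s. c * X s + e * X' s) (\<lambda>s. c * Y s + e * Y' s) s
        = c * (c1 s * X s + c2 s * Y s + c3 s * Z X Y s) + e * (c1 s * X' s + c2 s * Y' s + c3 s * Z X' Y' s)"
      by (simp add: algebra_simps)
  qed
  also have "\<dots> = c * volterra x0 d1 d2 c1 c2 c3 X Y x + e * volterra x0 d1 d2 c1 c2 c3 X' Y' x"
    unfolding volterra_def
    by (rule int_from_lincomb[OF x0 x]) (intro absolutely_integrable_lincomb3 coupling_continuous c XY)+
  finally show ?thesis .
qed

text \<open>In the weighted supremum norm with weight \<open>exp (- K H)\<close> the operators have norm at
  most \<open>1 / K\<close>; a large \<open>K\<close> turns them into contractions.\<close>

lemma volterra_bound:
  assumes c: "c1 absolutely_integrable_on {a..b}" "c2 absolutely_integrable_on {a..b}"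
    "c3 absolutely_integrable_on {a..b}"
    and ch: "\<And>s. norm (c1 s) + norm (c2 s) + norm (c3 s) \<le> h s"
    and K: "1 \<le> K" and M: "0 \<le> M"
    and XY: "continuous_on {a..b} X" "continuous_on {a..b} Y"
    and Xb: "\<And>s. s \<in> {a..b} \<Longrightarrow> norm (X s) \<le> M * exp (K * H s)"
    and Yb: "\<And>s. s \<in> {a..b} \<Longrightarrow> norm (Y s) \<le> M * exp (K * H s)"
    and x: "x \<in> {a..b}"
  shows "norm (volterra x0 d1 d2 c1 c2 c3 X Y x) \<le> M / K * exp (K * H x)"
proof -
  have h0: "0 \<le> h s" for s by (simp add: h_def)
  \<comment> \<open>The inner integral already gains \<open>1 / K\<close>; with
    \<open>1 \<le> K\<close> this factor is discarded, and \<open>Z\<close> obeys the same bound as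
    \<open>X\<close> and \<open>Y\<close>.\<close>
  have Zb: "norm (Z X Y s) \<le> M * exp (K * H s)" if s: "s \<in> {a..b}" for s
  proof -
    have "norm (Z X Y s) \<le> M / K * exp (K * H s)"
      unfolding coupling_def H_def
    proof (rule norm_int_from_le_exp[OF x0 h_integrable _ _ _ M _ s])
      fix r assume r: "r \<in> {a..b}"
      have "norm (d1 r * X r + d2 r * Y r) \<le> norm (d1 r) * norm (X r) + norm (d2 r) * norm (Y r)"
        by (metis norm_mult norm_triangle_ineq)
      also have "\<dots> \<le> norm (d1 r) * (M * exp (K * H r)) + norm (d2 r) * (M * exp (K * H r))"
        by (intro add_mono mult_left_mono Xb Yb r) auto
      also have "\<dots> = (norm (d1 r) + norm (d2 r)) * (M * exp (K * H r))" by (simp add: algebra_simps)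
      also have "\<dots> \<le> h r * (M * exp (K * H r))"
        using M by (intro mult_right_mono) (auto simp: h_def)
      finally show "norm (d1 r * X r + d2 r * Y r)
          \<le> M * (h r * exp (K * norm (int_from x0 (\<lambda>s. complex_of_real (h s)) r)))"
        by (simp add: H_def mult_ac)
    qed (use K h0 d XY in \<open>auto intro!: absolutely_integrable_lincomb2\<close>)
    also have "\<dots> \<le> M * exp (K * H s)"
      using K M by (intro mult_right_mono) (auto simp: divide_le_eq mult_le_cancel_left1)
    finally show ?thesis .
  qed
  show ?thesis
    unfolding volterra_def H_def
  proof (rule norm_int_from_le_exp[OF x0 h_integrable _ _ _ M _ x])
    fix r assume r: "r \<in> {a..b}"
    have "norm (c1 r * X r + c2 r * Y r + c3 r * Z X Y r)
        \<le> norm (c1 r) * norm (X r) + norm (c2 r) * norm (Y r) + norm (c3 r) * norm (Z X Y r)"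
      by (intro order_trans[OF norm_triangle_ineq] add_mono) (simp_all add: norm_mult)
    also have "\<dots> \<le> norm (c1 r) * (M * exp (K * H r)) + norm (c2 r) * (M * exp (K * H r))
        + norm (c3 r) * (M * exp (K * H r))"
      by (intro add_mono mult_left_mono Xb Yb Zb r) auto
    also have "\<dots> = (norm (c1 r) + norm (c2 r) + norm (c3 r)) * (M * exp (K * H r))"
      by (simp add: algebra_simps)
    also have "\<dots> \<le> h r * (M * exp (K * H r))"
      using M by (intro mult_right_mono ch) auto
    finally show "norm (c1 r * X r + c2 r * Y r + c3 r * Z X Y r)
        \<le> M * (h r * exp (K * norm (int_from x0 (\<lambda>s. complex_of_real (h s)) r)))"
      by (simp add: H_def mult_ac)
  qed (use K h0 c XY coupling_continuous[OF XY] in \<open>auto intro!: absolutely_integrable_lincomb3\<close>)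
qed

lemma TX_bound:
  assumes "1 \<le> K" "0 \<le> M" "continuous_on {a..b} X" "continuous_on {a..b} Y"
    and "\<And>s. s \<in> {a..b} \<Longrightarrow> norm (X s) \<le> M * exp (K * H s)"
    and "\<And>s. s \<in> {a..b} \<Longrightarrow> norm (Y s) \<le> M * exp (K * H s)" and "x \<in> {a..b}"
  shows "norm (TX X Y x) \<le> M / K * exp (K * H x)"
  by (rule volterra_bound[OF A _ assms]) (simp_all add: h_def)

lemma TY_bound:
  assumes "1 \<le> K" "0 \<le> M" "continuous_on {a..b} X" "continuous_on {a..b} Y"
    and "\<And>s. s \<in> {a..b} \<Longrightarrow> norm (X s) \<le> M * exp (K * H s)"
    and "\<And>s. s \<in> {a..b} \<Longrightarrow> norm (Y s) \<le> M * exp (K * H s)" and "x \<in> {a..b}"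
  shows "norm (TY X Y x) \<le> M / K * exp (K * H x)"
  by (rule volterra_bound[OF B _ assms]) (simp_all add: h_def)

section \<open>Convergence and summation of the Neumann series\<close>

lemma H_bound:
  obtains L where "\<And>x. x \<in> {a..b} \<Longrightarrow> H x \<le> L"
proof -
  have "(\<lambda>s. complex_of_real (h s)) absolutely_integrable_on {a..b}"
    using absolutely_integrable_linear[OF h_integrable bounded_linear_of_real] by (simp add: o_def)
  then have "continuous_on {a..b} (int_from x0 (\<lambda>s. complex_of_real (h s)))"
    by (intro ac_deriv_continuous_on[OF ac_deriv_int_from] x0)
  then have "bounded (int_from x0 (\<lambda>s. complex_of_real (h s)) ` {a..b})"
    by (intro compact_imp_bounded compact_continuous_image) auto
  then show thesis
    using that unfolding bounded_iff H_def by (metis image_eqI)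
qed

text \<open>Here \<open>lam\<close> is absorbed into the iterates, so each step applies
  \<open>lam * T\<close> and halves the weighted norm. As the weight is bounded on the interval, a
  geometric bound in the plain supremum norm follows.\<close>

lemma iterates:
  fixes X Y :: "nat \<Rightarrow> real \<Rightarrow> complex"
  assumes cont0: "continuous_on {a..b} (X 0)" "continuous_on {a..b} (Y 0)"
    and X: "\<And>n x. x \<in> {a..b} \<Longrightarrow> X (Suc n) x = lam * TX (X n) (Y n) x"
    and Y: "\<And>n x. x \<in> {a..b} \<Longrightarrow> Y (Suc n) x = lam * TY (X n) (Y n) x"
  shows iterates_continuous: "continuous_on {a..b} (X n) \<and> continuous_on {a..b} (Y n)"
    and iterates_bound: "\<exists>M\<ge>0. \<forall>n. \<forall>x\<in>{a..b}. norm (X n x) \<le> M * (1/2)^n \<and> norm (Y n x) \<le> M * (1/2)^n"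
proof -
  show cont: "continuous_on {a..b} (X n) \<and> continuous_on {a..b} (Y n)" for n
  proof (induction n)
    case (Suc n)
    have "continuous_on {a..b} (\<lambda>x. lam * TX (X n) (Y n) x)" "continuous_on {a..b} (\<lambda>x. lam * TY (X n) (Y n) x)"
      using Suc by (intro continuous_intros volterra_continuous A B; simp)+
    moreover have "continuous_on {a..b} (X (Suc n)) \<longleftrightarrow> continuous_on {a..b} (\<lambda>x. lam * TX (X n) (Y n) x)"
      "continuous_on {a..b} (Y (Suc n)) \<longleftrightarrow> continuous_on {a..b} (\<lambda>x. lam * TY (X n) (Y n) x)"
      by (rule continuous_on_cong[OF refl], rule X Y, assumption)+
    ultimately show ?case by blast
  qed (use cont0 in simp)
  have "bounded (X 0 ` {a..b})" "bounded (Y 0 ` {a..b})"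
    using cont0 by (auto intro!: compact_imp_bounded compact_continuous_image)
  then obtain MX MY where MX: "\<And>x. x \<in> {a..b} \<Longrightarrow> norm (X 0 x) \<le> MX"
    and MY: "\<And>x. x \<in> {a..b} \<Longrightarrow> norm (Y 0 x) \<le> MY"
    unfolding bounded_iff by (metis image_eqI)
  define M where "M = max 0 (max MX MY)"
  \<comment> \<open>Twice \<open>norm lam\<close> gives the ratio 1/2; the summand 1 ensures
    \<open>1 \<le> K\<close> even for \<open>lam = 0\<close>.\<close>
  define K where "K = 2 * norm lam + 1"
  have M: "0 \<le> M" "MX \<le> M" "MY \<le> M" by (auto simp: M_def)
  have "1 \<le> K" by (simp add: K_def)
  moreover have "norm lam \<le> 1/2 * K" by (simp add: K_def)
  ultimately have K: "1 \<le> K" "norm lam / K \<le> 1/2" by (simp_all add: pos_divide_le_eq)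
  have *: "norm (X n x) \<le> M * (1/2)^n * exp (K * H x) \<and> norm (Y n x) \<le> M * (1/2)^n * exp (K * H x)"
    if "x \<in> {a..b}" for n x
    using that
  proof (induction n arbitrary: x)
    case 0
    have "1 \<le> exp (K * H x)" using K by (simp add: H_def)
    then have "M \<le> M * exp (K * H x)" using M(1) mult_left_mono[of 1 "exp (K * H x)" M] by simp
    then show ?case using MX[OF 0] MY[OF 0] M by simp
  next
    case (Suc n)
    have step: "norm lam * (M * (1/2)^n / K * exp (K * H x)) \<le> M * (1/2)^Suc n * exp (K * H x)"
    proof -
      have "norm lam * (M * (1/2)^n / K * exp (K * H x)) = (norm lam / K) * (M * (1/2)^n * exp (K * H x))"
        by simp
      also have "\<dots> \<le> 1/2 * (M * (1/2)^n * exp (K * H x))"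
        using K(2) M(1) by (intro mult_right_mono) auto
      finally show ?thesis by simp
    qed
    have bX: "norm (TX (X n) (Y n) x) \<le> M * (1/2)^n / K * exp (K * H x)"
      by (rule TX_bound) (use Suc cont[of n] K(1) M(1) in auto)
    have bY: "norm (TY (X n) (Y n) x) \<le> M * (1/2)^n / K * exp (K * H x)"
      by (rule TY_bound) (use Suc cont[of n] K(1) M(1) in auto)
    have "norm (X (Suc n) x) \<le> norm lam * (M * (1/2)^n / K * exp (K * H x))"
      unfolding X[OF Suc.prems] norm_mult by (rule mult_left_mono[OF bX]) simp
    moreover have "norm (Y (Suc n) x) \<le> norm lam * (M * (1/2)^n / K * exp (K * H x))"
      unfolding Y[OF Suc.prems] norm_mult by (rule mult_left_mono[OF bY]) simp
    ultimately show ?case using step by linarith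
  qed
  \<comment> \<open>Removing the weight costs the factor \<open>exp (K * L)\<close> in the constant,
    but leaves the ratio unchanged.\<close>
  obtain L where L: "\<And>x. x \<in> {a..b} \<Longrightarrow> H x \<le> L" by (rule H_bound) blast
  have le: "M * (1/2)^n * exp (K * H x) \<le> M * exp (K * L) * (1/2)^n" if "x \<in> {a..b}" for x n
  proof -
    have "M * (1/2)^n * exp (K * H x) \<le> M * (1/2)^n * exp (K * L)"
      using L[OF that] K(1) M(1) by (intro mult_left_mono) (auto intro!: mult_left_mono)
    then show ?thesis by (simp add: mult_ac)
  qed
  show "\<exists>M\<ge>0. \<forall>n. \<forall>x\<in>{a..b}. norm (X n x) \<le> M * (1/2)^n \<and> norm (Y n x) \<le> M * (1/2)^n"
  proof (intro exI conjI allI ballI)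
    show "0 \<le> M * exp (K * L)" using M(1) by simp
    show "norm (X n x) \<le> M * exp (K * L) * (1/2)^n" "norm (Y n x) \<le> M * exp (K * L) * (1/2)^n"
      if "x \<in> {a..b}" for n x
      using *[OF that, of n] le[OF that, of n] by auto
  qed
qed

text \<open>A solution of the homogeneous equation forms a constant sequence of iterates, so it is
  bounded by \<open>M * (1/2)^n\<close> for every \<open>n\<close>.\<close>

lemma fixed_point_zero:
  assumes cont: "continuous_on {a..b} X" "continuous_on {a..b} Y"
    and X: "\<And>x. x \<in> {a..b} \<Longrightarrow> X x = lam * TX X Y x"
    and Y: "\<And>x. x \<in> {a..b} \<Longrightarrow> Y x = lam * TY X Y x"
    and x: "x \<in> {a..b}"
  shows "X x = 0" "Y x = 0"
proof -
  obtain M where M: "\<And>n. norm (X x) \<le> M * (1/2)^n \<and> norm (Y x) \<le> M * (1/2)^n"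
    using iterates_bound[of "\<lambda>_. X" "\<lambda>_. Y", OF cont X Y] x by blast
  have lim: "(\<lambda>n. M * (1/2)^n) \<longlonglongrightarrow> 0"
    by (intro tendsto_mult_right_zero LIMSEQ_power_zero) simp
  have "norm (X x) \<le> 0" "norm (Y x) \<le> 0"
    by (rule LIMSEQ_le_const[OF lim]; use M in blast)+
  then show "X x = 0" "Y x = 0" by auto
qed

lemma volterra_zero: "volterra x0 d1 d2 c1 c2 c3 (\<lambda>_. 0) (\<lambda>_. 0) x = 0"
  using volterra_cmult[of x0 d1 d2 c1 c2 c3 0 "\<lambda>_. 0" "\<lambda>_. 0" x] by simp

lemma volterra_sum:
  fixes X Y :: "nat \<Rightarrow> real \<Rightarrow> complex"
  assumes c: "c1 absolutely_integrable_on {a..b}" "c2 absolutely_integrable_on {a..b}"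
    "c3 absolutely_integrable_on {a..b}" and x: "x \<in> {a..b}"
    and XY: "\<And>n. continuous_on {a..b} (X n)" "\<And>n. continuous_on {a..b} (Y n)"
  shows "volterra x0 d1 d2 c1 c2 c3 (\<lambda>s. \<Sum>i<n. X i s) (\<lambda>s. \<Sum>i<n. Y i s) x
    = (\<Sum>i<n. volterra x0 d1 d2 c1 c2 c3 (X i) (Y i) x)"
proof (induction n)
  case (Suc n)
  have "continuous_on {a..b} (\<lambda>s. \<Sum>i<n. X i s)" "continuous_on {a..b} (\<lambda>s. \<Sum>i<n. Y i s)"
    by (intro continuous_intros XY)+
  from volterra_lincomb[OF c x this XY(1)[of n] XY(2)[of n], of 1 1] Suc
  show ?case by simp
qed (simp add: volterra_zero)

text \<open>The geometric bound gives uniform convergence, and \<open>T\<close> is continuous for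
  it. The sum of the first \<open>n + 1\<close> iterates is the initial one plus
  \<open>lam * T\<close> of the sum of the first \<open>n\<close>; the claim is the limit of this
  identity.\<close>

lemma iterates_sum:
  fixes X Y :: "nat \<Rightarrow> real \<Rightarrow> complex"
  assumes cont0: "continuous_on {a..b} (X 0)" "continuous_on {a..b} (Y 0)"
    and X: "\<And>n x. x \<in> {a..b} \<Longrightarrow> X (Suc n) x = lam * TX (X n) (Y n) x"
    and Y: "\<And>n x. x \<in> {a..b} \<Longrightarrow> Y (Suc n) x = lam * TY (X n) (Y n) x"
  defines "SX \<equiv> \<lambda>x. \<Sum>n. X n x" and "SY \<equiv> \<lambda>x. \<Sum>n. Y n x"
  shows iterates_sum_continuous: "continuous_on {a..b} SX" "continuous_on {a..b} SY"
    and iterates_sum_X: "x \<in> {a..b} \<Longrightarrow> SX x = X 0 x + lam * TX SX SY x"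
    and iterates_sum_Y: "x \<in> {a..b} \<Longrightarrow> SY x = Y 0 x + lam * TY SX SY x"
proof -
  have cont: "continuous_on {a..b} (X n)" "continuous_on {a..b} (Y n)" for n
    using iterates_continuous[OF cont0 X Y] by auto
  obtain M where M: "\<And>n x. x \<in> {a..b} \<Longrightarrow> norm (X n x) \<le> M * (1/2)^n"
      "\<And>n x. x \<in> {a..b} \<Longrightarrow> norm (Y n x) \<le> M * (1/2)^n"
    using iterates_bound[OF cont0 X Y] by blast
  have summable: "summable (\<lambda>n. M * (1/2::real)^n)"
    by (intro summable_mult summable_geometric) simp
  have limX: "uniform_limit {a..b} (\<lambda>n x. \<Sum>i<n. X i x) SX sequentially"
    unfolding SX_def by (rule Weierstrass_m_test[OF M(1) summable])
  have limY: "uniform_limit {a..b} (\<lambda>n x. \<Sum>i<n. Y i x) SY sequentially"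
    unfolding SY_def by (rule Weierstrass_m_test[OF M(2) summable])
  have contS: "continuous_on {a..b} (\<lambda>x. \<Sum>i<n. X i x)" "continuous_on {a..b} (\<lambda>x. \<Sum>i<n. Y i x)" for n
    by (intro continuous_intros cont)+
  show SX: "continuous_on {a..b} SX"
    by (rule uniform_limit_theorem[OF _ limX]) (use contS in auto)
  show SY: "continuous_on {a..b} SY"
    by (rule uniform_limit_theorem[OF _ limY]) (use contS in auto)
  \<comment> \<open>Stated for a generic coefficient triple, so that it covers both components:
    \<open>W\<close> is either the sequence \<open>X\<close> or the sequence
    \<open>Y\<close>.\<close>
  have key: "S x = W 0 x + lam * volterra x0 d1 d2 c1 c2 c3 SX SY x"
    if c: "c1 absolutely_integrable_on {a..b}" "c2 absolutely_integrable_on {a..b}"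
      "c3 absolutely_integrable_on {a..b}"
      and ch: "\<And>s. norm (c1 s) + norm (c2 s) + norm (c3 s) \<le> h s"
      and W: "\<And>n x. x \<in> {a..b} \<Longrightarrow> W (Suc n) x = lam * volterra x0 d1 d2 c1 c2 c3 (X n) (Y n) x"
      and S: "uniform_limit {a..b} (\<lambda>n x. \<Sum>i<n. W i x) S sequentially"
      and x: "x \<in> {a..b}"
    for W :: "nat \<Rightarrow> real \<Rightarrow> complex" and S c1 c2 c3
  proof -
    let ?V = "volterra x0 d1 d2 c1 c2 c3"
    have "(\<lambda>n. \<Sum>i<n. ?V (X i) (Y i) x) \<longlonglongrightarrow> ?V SX SY x"
    proof (rule LIMSEQ_I)
      fix r :: real assume "0 < r"
      \<comment> \<open>The weighted bound is applied with \<open>K = 1\<close> and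
        \<open>M = e\<close>; this \<open>e\<close> turns it into \<open>r / 2\<close> at the point
        \<open>x\<close>.\<close>
      define e where "e = r / (2 * exp (H x))"
      have "0 < e" using \<open>0 < r\<close> by (simp add: e_def)
      have "eventually (\<lambda>n. \<forall>s\<in>{a..b}. dist (\<Sum>i<n. X i s) (SX s) < e) sequentially"
        "eventually (\<lambda>n. \<forall>s\<in>{a..b}. dist (\<Sum>i<n. Y i s) (SY s) < e) sequentially"
        using limX limY \<open>0 < e\<close> unfolding uniform_limit_iff by blast+
      then have "eventually (\<lambda>n. \<forall>s\<in>{a..b}. dist (\<Sum>i<n. X i s) (SX s) < e \<and> dist (\<Sum>i<n. Y i s) (SY s) < e) sequentially"
        by eventually_elim blast
      then obtain N where N: "\<And>n s. \<lbrakk>N \<le> n; s \<in> {a..b}\<rbrakk> \<Longrightarrow>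
          dist (\<Sum>i<n. X i s) (SX s) < e \<and> dist (\<Sum>i<n. Y i s) (SY s) < e"
        unfolding eventually_sequentially by blast
      have "norm ((\<Sum>i<n. ?V (X i) (Y i) x) - ?V SX SY x) < r" if "N \<le> n" for n
      proof -
        \<comment> \<open>The explicit factors give the differences the shape of a linear
          combination, so that linearity of the operator applies verbatim.\<close>
        let ?DX = "\<lambda>s. 1 * (\<Sum>i<n. X i s) + (-1) * SX s" and ?DY = "\<lambda>s. 1 * (\<Sum>i<n. Y i s) + (-1) * SY s"
        have eH: "e \<le> e * exp (1 * H s)" for s
          using \<open>0 < e\<close> by (simp add: H_def)
        have "norm (?DX s) \<le> e * exp (1 * H s)" "norm (?DY s) \<le> e * exp (1 * H s)" if "s \<in> {a..b}" for s
          using N[OF \<open>N \<le> n\<close> that] eH[of s] by (auto simp: dist_norm)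
        then have "norm (?V ?DX ?DY x) \<le> e / 1 * exp (1 * H x)"
          using \<open>0 < e\<close> by (intro volterra_bound c ch x continuous_intros contS SX SY) auto
        also have "\<dots> < r" using \<open>0 < r\<close> by (simp add: e_def)
        also have "?V ?DX ?DY x = (\<Sum>i<n. ?V (X i) (Y i) x) - ?V SX SY x"
          by (subst volterra_lincomb[OF c x contS SX SY]) (simp add: volterra_sum[OF c x cont])
        finally show ?thesis .
      qed
      then show "\<exists>N. \<forall>n\<ge>N. norm ((\<Sum>i<n. ?V (X i) (Y i) x) - ?V SX SY x) < r" by blast
    qed
    then have "(\<lambda>n. W 0 x + lam * (\<Sum>i<n. ?V (X i) (Y i) x)) \<longlonglongrightarrow> W 0 x + lam * ?V SX SY x"
      by (intro tendsto_intros)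
    moreover have "W 0 x + lam * (\<Sum>i<n. ?V (X i) (Y i) x) = (\<Sum>i<Suc n. W i x)" for n
      by (subst sum.lessThan_Suc_shift) (simp add: W[OF x] sum_distrib_left)
    ultimately have "(\<lambda>n. \<Sum>i<Suc n. W i x) \<longlonglongrightarrow> W 0 x + lam * ?V SX SY x"
      by simp
    then have "(\<lambda>n. \<Sum>i<n. W i x) \<longlonglongrightarrow> W 0 x + lam * ?V SX SY x"
      by (rule LIMSEQ_imp_Suc)
    then show ?thesis
      using tendsto_uniform_limitI[OF S x] LIMSEQ_unique by blast
  qed
  show "SX x = X 0 x + lam * TX SX SY x" if "x \<in> {a..b}"
    by (rule key[OF A _ X limX that]) (simp add: h_def)
  show "SY x = Y 0 x + lam * TY SX SY x" if "x \<in> {a..b}"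
    by (rule key[OF B _ Y limY that]) (simp add: h_def)
qed

end

section \<open>The transformed system\<close>

lemma ac_deriv_cong_deriv:
  assumes "ac_deriv a b u k" "\<And>x. x \<in> {a..b} \<Longrightarrow> k x = l x"
  shows "ac_deriv a b u l"
  using assms(1) by (rule ac_deriv_cong_AE) (use assms(2) in simp)

lemma ac_deriv_lincomb_eq_int_from:
  assumes u: "ac_deriv a b u (\<lambda>s. c * k s + d * l s)"
    and k: "k absolutely_integrable_on {a..b}" and l: "l absolutely_integrable_on {a..b}"
    and x: "x0 \<in> {a..b}" "x \<in> {a..b}"
  shows "u x = u x0 + c * int_from x0 k x + d * int_from x0 l x"
proof -
  have "(\<lambda>s. c * k s + d * l s) absolutely_integrable_on {a..b}"
    by (rule set_integral_add[OF set_integrable_mult_right[OF k] set_integrable_mult_right[OF l]])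
  from ac_deriv_eq_int_from[OF u this x] show ?thesis
    by (simp add: int_from_lincomb[OF x k l])
qed

text \<open>If \<open>u' = k u\<close> with integrable \<open>k\<close>, then \<open>u exp (- \<integral>k)\<close> is constant, so that a single zero
  forces \<open>u = 0\<close> identically.\<close>

lemma ac_deriv_linear_nonzero:
  assumes "a < b" and u: "ac_deriv a b u u'" and k: "k absolutely_integrable_on {a..b}"
    and eq: "AE x\<in>{a..b} in lebesgue. u' x = k x * u x"
    and nz: "AE x\<in>{a..b} in lebesgue. u x \<noteq> 0"
    and x: "x \<in> {a..b}"
  shows "u x \<noteq> 0"
proof
  assume "u x = 0"
  let ?E = "\<lambda>t. exp (-1 * int_from x k t)"
  have "ac_deriv a b (\<lambda>t. ?E t * u t) (\<lambda>t. ?E t * u' t + (-1 * k t) * ?E t * u t)"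
    by (intro ac_deriv_mult ac_deriv_exp ac_deriv_cmult ac_deriv_int_from k x u)
  then have "ac_deriv a b (\<lambda>t. ?E t * u t) (\<lambda>_. 0)"
    by (rule ac_deriv_cong_AE) (rule AE_lebesgue_mono[OF eq], simp)
  from ac_deriv_zero_imp_eq[OF this x] \<open>u x = 0\<close> have "u t = 0" if "t \<in> {a..b}" for t
    using that by fastforce
  \<comment> \<open>Vanishing everywhere contradicts \<open>nz\<close>, because the interval has
    positive measure for \<open>a < b\<close>.\<close>
  then have "AE t\<in>{a..b} in lebesgue. False"
    by (intro AE_lebesgue_mono[OF nz]) auto
  then have "{a..b} \<in> null_sets lebesgue"
    by (auto simp: AE_iff_null_sets)
  with \<open>a < b\<close> show False
    by (simp add: null_sets_def)
qed

text \<open>The homogeneous system is written in components, and \<open>f\<close>, \<open>g\<close>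
  are assumed free of zeros on the whole interval; the final theorem derives this from its almost
  everywhere hypotheses.\<close>

locale dirac_system =
  fixes a b x0 :: real and p1 p2 q r11 r12 r21 r22 f g :: "real \<Rightarrow> complex"
  assumes x0: "x0 \<in> {a..b}"
    and r: "r11 absolutely_integrable_on {a..b}" "r12 absolutely_integrable_on {a..b}"
      "r21 absolutely_integrable_on {a..b}" "r22 absolutely_integrable_on {a..b}"
    and f: "ac_deriv a b f (\<lambda>x. q x * f x + p2 x * g x)"
    and g: "ac_deriv a b g (\<lambda>x. - p1 x * f x - q x * g x)"
    and f0: "\<And>x. x \<in> {a..b} \<Longrightarrow> f x \<noteq> 0"
    and g0: "\<And>x. x \<in> {a..b} \<Longrightarrow> g x \<noteq> 0"
    and quot: "(\<lambda>x. p2 x / (f x)\<^sup>2) absolutely_integrable_on {a..b}"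
      "(\<lambda>x. p1 x / (g x)\<^sup>2) absolutely_integrable_on {a..b}"
      "(\<lambda>x. r11 x * (f x / g x)) absolutely_integrable_on {a..b}"
      "(\<lambda>x. r22 x * (g x / f x)) absolutely_integrable_on {a..b}"
begin

sublocale volterra_system a b x0
  "\<lambda>s. - r21 s" "\<lambda>s. - (r22 s * (g s / f s))" "\<lambda>s. p2 s / (f s)\<^sup>2"
  "\<lambda>s. r11 s * (f s / g s)" r12 "\<lambda>s. p1 s / (g s)\<^sup>2"
  "\<lambda>s. (f s)\<^sup>2 * r11 s + f s * g s * r21 s" "\<lambda>s. f s * g s * r12 s + (g s)\<^sup>2 * r22 s"
proof
  have c: "continuous_on {a..b} f" "continuous_on {a..b} g"
    using f g by (auto intro: ac_deriv_continuous_on)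
  show "(\<lambda>s. (f s)\<^sup>2 * r11 s + f s * g s * r21 s) absolutely_integrable_on {a..b}"
    "(\<lambda>s. f s * g s * r12 s + (g s)\<^sup>2 * r22 s) absolutely_integrable_on {a..b}"
    using absolutely_integrable_lincomb2[OF r(1,3), of "\<lambda>s. (f s)\<^sup>2" "\<lambda>s. f s * g s"]
      absolutely_integrable_lincomb2[OF r(2,4), of "\<lambda>s. f s * g s" "\<lambda>s. (g s)\<^sup>2"] c
    by (simp_all add: mult.commute continuous_intros)
qed (use x0 r quot set_integrable_mult_right[of "-1", OF r(3)] set_integrable_mult_right[of "-1", OF quot(4)]
    in simp_all)

text \<open>The system solved for the derivatives. Since \<open>B\<close> maps
  \<open>(u', v')\<close> to \<open>(v', - u')\<close>, the derivative of \<open>u\<close> comes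
  from the second row and that of \<open>v\<close> from the first.\<close>

definition solution :: "complex \<Rightarrow> (real \<Rightarrow> complex) \<Rightarrow> (real \<Rightarrow> complex) \<Rightarrow> bool" where
  "solution lam u v \<longleftrightarrow>
     ac_deriv a b u (\<lambda>x. q x * u x + p2 x * v x - lam * (r21 x * u x + r22 x * v x)) \<and>
     ac_deriv a b v (\<lambda>x. - p1 x * u x - q x * v x + lam * (r11 x * u x + r12 x * v x))"

text \<open>Here \<open>c1\<close>, \<open>c2\<close> are the values of \<open>X\<close>,
  \<open>Y\<close> at \<open>x0\<close>, so \<open>f x0 * g x0 * (c2 - c1)\<close> is the value of
  \<open>W\<close> there. The pair with \<open>(c1, c2) = (0, 1)\<close> starts the formal powers,
  the one with \<open>(1, 0)\<close> their tilde variants.\<close>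

definition X0 :: "complex \<Rightarrow> complex \<Rightarrow> real \<Rightarrow> complex" where
  "X0 c1 c2 x = c1 + f x0 * g x0 * (c2 - c1) * int_from x0 (\<lambda>s. p2 s / (f s)\<^sup>2) x"

definition Y0 :: "complex \<Rightarrow> complex \<Rightarrow> real \<Rightarrow> complex" where
  "Y0 c1 c2 x = c2 + f x0 * g x0 * (c2 - c1) * int_from x0 (\<lambda>s. p1 s / (g s)\<^sup>2) x"

definition fixed_point :: "complex \<Rightarrow> complex \<Rightarrow> complex \<Rightarrow> (real \<Rightarrow> complex) \<Rightarrow> (real \<Rightarrow> complex) \<Rightarrow> bool" where
  "fixed_point lam c1 c2 X Y \<longleftrightarrow> continuous_on {a..b} X \<and> continuous_on {a..b} Y \<and>
     (\<forall>x\<in>{a..b}. X x = X0 c1 c2 x + lam * TX X Y x \<and> Y x = Y0 c1 c2 x + lam * TY X Y x)"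

text \<open>In the derivative of \<open>f v - g u\<close>, which is \<open>f g (Y - X)\<close>, all
  terms with \<open>p1\<close>, \<open>p2\<close> and \<open>q\<close> cancel and only multiples of
  \<open>lam\<close> remain. The same expression reappears in the quotient rule for
  \<open>u / f\<close> and \<open>v / g\<close>, where it is replaced by its primitive.\<close>

lemma solution_imp_fixed_point:
  assumes "solution lam u v"
  shows "fixed_point lam (u x0 / f x0) (v x0 / g x0) (\<lambda>x. u x / f x) (\<lambda>x. v x / g x)"
proof -
  let ?X = "\<lambda>x. u x / f x" and ?Y = "\<lambda>x. v x / g x"
  define w where "w = f x0 * g x0 * (?Y x0 - ?X x0)"
  have u: "ac_deriv a b u (\<lambda>x. q x * u x + p2 x * v x - lam * (r21 x * u x + r22 x * v x))"
    and v: "ac_deriv a b v (\<lambda>x. - p1 x * u x - q x * v x + lam * (r11 x * u x + r12 x * v x))"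
    using assms by (auto simp: solution_def)
  have X: "continuous_on {a..b} ?X" and Y: "continuous_on {a..b} ?Y"
    using f0 g0 by (auto intro!: continuous_on_divide ac_deriv_continuous_on[OF f] ac_deriv_continuous_on[OF g]
        ac_deriv_continuous_on[OF u] ac_deriv_continuous_on[OF v])
  have W: "f x * v x - g x * u x = w + lam * Z ?X ?Y x" if x: "x \<in> {a..b}" for x
  proof -
    let ?d = "\<lambda>s. ((f s)\<^sup>2 * r11 s + f s * g s * r21 s) * ?X s + (f s * g s * r12 s + (g s)\<^sup>2 * r22 s) * ?Y s"
    have "ac_deriv a b (\<lambda>x. f x * v x - g x * u x) (\<lambda>s. lam * ?d s)"
      by (rule ac_deriv_cong_deriv[OF ac_deriv_diff[OF ac_deriv_mult[OF f v] ac_deriv_mult[OF g u]]])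
        (use f0 g0 in \<open>simp add: field_simps power2_eq_square\<close>)
    then have "f x * v x - g x * u x = f x0 * v x0 - g x0 * u x0 + int_from x0 (\<lambda>s. lam * ?d s) x"
      by (rule ac_deriv_eq_int_from[OF _ set_integrable_mult_right[OF absolutely_integrable_lincomb2[OF d X Y]] x0 x])
    also have "f x0 * v x0 - g x0 * u x0 = w"
      using f0[OF x0] g0[OF x0] by (simp add: w_def field_simps)
    finally show ?thesis by (simp add: int_from_cmult coupling_def)
  qed
  have "ac_deriv a b ?X (\<lambda>s. w * (p2 s / (f s)\<^sup>2) + lam * (- r21 s * ?X s + - (r22 s * (g s / f s)) * ?Y s
      + p2 s / (f s)\<^sup>2 * Z ?X ?Y s))"
  proof (rule ac_deriv_cong_deriv)
    show "ac_deriv a b ?X (\<lambda>s. u s * (- (q s * f s + p2 s * g s) / (f s)\<^sup>2)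
        + (q s * u s + p2 s * v s - lam * (r21 s * u s + r22 s * v s)) * inverse (f s))"
      unfolding divide_inverse[of "u _"] by (intro ac_deriv_mult ac_deriv_inverse f u f0)
    fix s assume s: "s \<in> {a..b}"
    have "w * (p2 s / (f s)\<^sup>2) + lam * (- r21 s * ?X s + - (r22 s * (g s / f s)) * ?Y s
      + p2 s / (f s)\<^sup>2 * Z ?X ?Y s)
      = p2 s / (f s)\<^sup>2 * (w + lam * Z ?X ?Y s) + lam * (- r21 s * ?X s + - (r22 s * (g s / f s)) * ?Y s)"
      by (simp add: algebra_simps)
    also have "\<dots> = u s * (- (q s * f s + p2 s * g s) / (f s)\<^sup>2)
        + (q s * u s + p2 s * v s - lam * (r21 s * u s + r22 s * v s)) * inverse (f s)"
      unfolding W[OF s, symmetric] using f0[OF s] g0[OF s] by (simp add: field_simps power2_eq_square)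
    finally show "u s * (- (q s * f s + p2 s * g s) / (f s)\<^sup>2)
        + (q s * u s + p2 s * v s - lam * (r21 s * u s + r22 s * v s)) * inverse (f s)
      = w * (p2 s / (f s)\<^sup>2) + lam * (- r21 s * ?X s + - (r22 s * (g s / f s)) * ?Y s
      + p2 s / (f s)\<^sup>2 * Z ?X ?Y s)" ..
  qed
  then have Xeq: "?X x = X0 (?X x0) (?Y x0) x + lam * TX ?X ?Y x" if x: "x \<in> {a..b}" for x
    unfolding X0_def volterra_def w_def[symmetric]
    by (rule ac_deriv_lincomb_eq_int_from[OF _ A(3) absolutely_integrable_lincomb3[OF A X Y coupling_continuous[OF X Y]] x0 x])
  have "ac_deriv a b ?Y (\<lambda>s. w * (p1 s / (g s)\<^sup>2) + lam * (r11 s * (f s / g s) * ?X s + r12 s * ?Y s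
      + p1 s / (g s)\<^sup>2 * Z ?X ?Y s))"
  proof (rule ac_deriv_cong_deriv)
    show "ac_deriv a b ?Y (\<lambda>s. v s * (- (- p1 s * f s - q s * g s) / (g s)\<^sup>2)
        + (- p1 s * u s - q s * v s + lam * (r11 s * u s + r12 s * v s)) * inverse (g s))"
      unfolding divide_inverse[of "v _"] by (intro ac_deriv_mult ac_deriv_inverse g v g0)
    fix s assume s: "s \<in> {a..b}"
    have "w * (p1 s / (g s)\<^sup>2) + lam * (r11 s * (f s / g s) * ?X s + r12 s * ?Y s
      + p1 s / (g s)\<^sup>2 * Z ?X ?Y s)
      = p1 s / (g s)\<^sup>2 * (w + lam * Z ?X ?Y s) + lam * (r11 s * (f s / g s) * ?X s + r12 s * ?Y s)"
      by (simp add: algebra_simps)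
    also have "\<dots> = v s * (- (- p1 s * f s - q s * g s) / (g s)\<^sup>2)
        + (- p1 s * u s - q s * v s + lam * (r11 s * u s + r12 s * v s)) * inverse (g s)"
      unfolding W[OF s, symmetric] using f0[OF s] g0[OF s] by (simp add: field_simps power2_eq_square)
    finally show "v s * (- (- p1 s * f s - q s * g s) / (g s)\<^sup>2)
        + (- p1 s * u s - q s * v s + lam * (r11 s * u s + r12 s * v s)) * inverse (g s)
      = w * (p1 s / (g s)\<^sup>2) + lam * (r11 s * (f s / g s) * ?X s + r12 s * ?Y s
      + p1 s / (g s)\<^sup>2 * Z ?X ?Y s)" ..
  qed
  then have Yeq: "?Y x = Y0 (?X x0) (?Y x0) x + lam * TY ?X ?Y x" if x: "x \<in> {a..b}" for x
    unfolding Y0_def volterra_def w_def[symmetric]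
    by (rule ac_deriv_lincomb_eq_int_from[OF _ B(3) absolutely_integrable_lincomb3[OF B X Y coupling_continuous[OF X Y]] x0 x])
  show ?thesis
    unfolding fixed_point_def using X Y Xeq Yeq by blast
qed

text \<open>Differentiating the equation yields derivatives containing \<open>w + lam * Z\<close>
  where the system needs \<open>f g (Y - X)\<close>. These two agree at \<open>x0\<close> by the
  choice of \<open>X0\<close> and \<open>Y0\<close>; once they agree everywhere, the product rule
  for \<open>f X\<close> and \<open>g Y\<close> gives back the system.\<close>

lemma fixed_point_imp_solution:
  assumes "fixed_point lam c1 c2 X Y"
  shows "solution lam (\<lambda>x. f x * X x) (\<lambda>x. g x * Y x)"
proof -
  define w where "w = f x0 * g x0 * (c2 - c1)"
  have X: "continuous_on {a..b} X" and Y: "continuous_on {a..b} Y"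
    and Xeq: "\<And>x. x \<in> {a..b} \<Longrightarrow> X x = X0 c1 c2 x + lam * TX X Y x"
    and Yeq: "\<And>x. x \<in> {a..b} \<Longrightarrow> Y x = Y0 c1 c2 x + lam * TY X Y x"
    using assms by (auto simp: fixed_point_def)
  let ?W = "\<lambda>x. w + lam * Z X Y x"
  let ?X' = "\<lambda>s. p2 s / (f s)\<^sup>2 * ?W s + lam * (- r21 s * X s - r22 s * (g s / f s) * Y s)"
  let ?Y' = "\<lambda>s. p1 s / (g s)\<^sup>2 * ?W s + lam * (r11 s * (f s / g s) * X s + r12 s * Y s)"
  let ?d = "\<lambda>s. ((f s)\<^sup>2 * r11 s + f s * g s * r21 s) * X s + (f s * g s * r12 s + (g s)\<^sup>2 * r22 s) * Y s"
  have W: "ac_deriv a b ?W (\<lambda>s. lam * ?d s)"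
    by (rule ac_deriv_cong_deriv[OF ac_deriv_add[OF ac_deriv_const ac_deriv_cmult[OF ac_deriv_coupling[OF X Y]]]]) simp
  have "ac_deriv a b (\<lambda>x. X0 c1 c2 x + lam * TX X Y x)
      (\<lambda>s. (0 + w * (p2 s / (f s)\<^sup>2)) + lam * (- r21 s * X s + - (r22 s * (g s / f s)) * Y s + p2 s / (f s)\<^sup>2 * Z X Y s))"
    unfolding X0_def w_def[symmetric]
    by (intro ac_deriv_add ac_deriv_const ac_deriv_cmult ac_deriv_int_from ac_deriv_volterra A x0 X Y)
  then have X': "ac_deriv a b X ?X'"
    by (rule ac_deriv_cong_deriv[OF ac_deriv_cong]) (simp_all add: Xeq algebra_simps)
  have "ac_deriv a b (\<lambda>x. Y0 c1 c2 x + lam * TY X Y x)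
      (\<lambda>s. (0 + w * (p1 s / (g s)\<^sup>2)) + lam * (r11 s * (f s / g s) * X s + r12 s * Y s + p1 s / (g s)\<^sup>2 * Z X Y s))"
    unfolding Y0_def w_def[symmetric]
    by (intro ac_deriv_add ac_deriv_const ac_deriv_cmult ac_deriv_int_from ac_deriv_volterra B x0 X Y)
  then have Y': "ac_deriv a b Y ?Y'"
    by (rule ac_deriv_cong_deriv[OF ac_deriv_cong]) (simp_all add: Yeq algebra_simps)
  \<comment> \<open>\<open>D\<close> and \<open>f g\<close> solve the same homogeneous linear equation, so \<open>D / (f g)\<close> is constant.\<close>
  let ?D = "\<lambda>x. ?W x - f x * g x * (Y x - X x)"
  let ?k = "\<lambda>s. p2 s * g s / f s - p1 s * f s / g s"
  have fg: "ac_deriv a b (\<lambda>x. f x * g x) (\<lambda>s. ?k s * (f s * g s))"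
    by (rule ac_deriv_cong_deriv[OF ac_deriv_mult[OF f g]])
      (use f0 g0 in \<open>simp add: field_simps power2_eq_square\<close>)
  have "ac_deriv a b ?D (\<lambda>s. ?k s * ?D s)"
  proof (rule ac_deriv_cong_deriv[OF ac_deriv_diff[OF W ac_deriv_mult[OF fg ac_deriv_diff[OF Y' X']]]])
    fix s assume s: "s \<in> {a..b}"
    have "f s \<noteq> 0" "g s \<noteq> 0" using f0 g0 s by auto
    \<comment> \<open>Generalized over \<open>F\<close>, \<open>G\<close> and \<open>V\<close>, so
      that clearing denominators treats \<open>f s\<close>, \<open>g s\<close> and the integral term
      \<open>?W s\<close> as atoms.\<close>
    then have "F * G * ((p1 s / G\<^sup>2 * V + lam * (r11 s * (F / G) * X s + r12 s * Y s))
          - (p2 s / F\<^sup>2 * V + lam * (- r21 s * X s - r22 s * (G / F) * Y s)))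
        = (p1 s * F / G - p2 s * G / F) * V + lam * ((F\<^sup>2 * r11 s + F * G * r21 s) * X s
            + (F * G * r12 s + G\<^sup>2 * r22 s) * Y s)"
      if "F \<noteq> 0" "G \<noteq> 0" for F G V
      using that by (simp add: field_simps power2_eq_square)
    note * = this[OF \<open>f s \<noteq> 0\<close> \<open>g s \<noteq> 0\<close>, of "?W s"]
    show "lam * ?d s - (f s * g s * (?Y' s - ?X' s) + ?k s * (f s * g s) * (Y s - X s)) = ?k s * ?D s"
      unfolding * by (simp add: algebra_simps)
  qed
  from ac_deriv_mult[OF this ac_deriv_inverse[OF fg]]
  have "ac_deriv a b (\<lambda>x. ?D x * inverse (f x * g x)) (\<lambda>s. ?D s * (- (?k s * (f s * g s)) / (f s * g s)\<^sup>2)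
      + ?k s * ?D s * inverse (f s * g s))"
    using f0 g0 by simp
  then have const: "ac_deriv a b (\<lambda>x. ?D x * inverse (f x * g x)) (\<lambda>s. 0)"
  proof (rule ac_deriv_cong_deriv)
    have alg: "E * (- (k * m) / m\<^sup>2) + k * E * inverse m = 0" if "m \<noteq> 0" for E k m :: complex
      using that by (simp add: field_simps power2_eq_square)
    show "?D s * (- (?k s * (f s * g s)) / (f s * g s)\<^sup>2) + ?k s * ?D s * inverse (f s * g s) = 0"
      if "s \<in> {a..b}" for s
      by (rule alg) (use f0[OF that] g0[OF that] in simp)
  qed
  \<comment> \<open>At \<open>x0\<close> every integral in the equation vanishes.\<close>
  have "X x0 = c1" "Y x0 = c2"
    using Xeq[OF x0] Yeq[OF x0] by (simp_all add: X0_def Y0_def volterra_def int_from_self)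
  then have "?D x0 = 0"
    by (simp add: w_def coupling_def int_from_self)
  have D: "?W x = f x * g x * (Y x - X x)" if x: "x \<in> {a..b}" for x
    using ac_deriv_zero_imp_eq[OF const x0 x] \<open>?D x0 = 0\<close> f0[OF x] g0[OF x] by simp
  show ?thesis
    unfolding solution_def
  proof
    show "ac_deriv a b (\<lambda>x. f x * X x) (\<lambda>x. q x * (f x * X x) + p2 x * (g x * Y x)
        - lam * (r21 x * (f x * X x) + r22 x * (g x * Y x)))"
    proof (rule ac_deriv_cong_deriv[OF ac_deriv_mult[OF f X']])
      fix s assume s: "s \<in> {a..b}"
      show "f s * ?X' s + (q s * f s + p2 s * g s) * X s = q s * (f s * X s) + p2 s * (g s * Y s)
        - lam * (r21 s * (f s * X s) + r22 s * (g s * Y s))"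
        unfolding D[OF s] using f0[OF s] g0[OF s] by (simp add: field_simps power2_eq_square)
    qed
    show "ac_deriv a b (\<lambda>x. g x * Y x) (\<lambda>x. - p1 x * (f x * X x) - q x * (g x * Y x)
        + lam * (r11 x * (f x * X x) + r12 x * (g x * Y x)))"
    proof (rule ac_deriv_cong_deriv[OF ac_deriv_mult[OF g Y']])
      fix s assume s: "s \<in> {a..b}"
      show "g s * ?Y' s + (- p1 s * f s - q s * g s) * Y s = - p1 s * (f s * X s) - q s * (g s * Y s)
        + lam * (r11 s * (f s * X s) + r12 s * (g s * Y s))"
        unfolding D[OF s] using f0[OF s] g0[OF s] by (simp add: field_simps power2_eq_square)
    qed
  qed
qed

section \<open>Superposition, uniqueness and the general solution\<close>

lemma fixed_point_lincomb:
  assumes "fixed_point lam c1 c2 X Y" "fixed_point lam c1' c2' X' Y'"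
  shows "fixed_point lam (c * c1 + e * c1') (c * c2 + e * c2')
    (\<lambda>x. c * X x + e * X' x) (\<lambda>x. c * Y x + e * Y' x)"
proof -
  have c: "continuous_on {a..b} X" "continuous_on {a..b} Y" "continuous_on {a..b} X'" "continuous_on {a..b} Y'"
    using assms by (auto simp: fixed_point_def)
  show ?thesis
    unfolding fixed_point_def
  proof (intro conjI ballI)
    fix x assume x: "x \<in> {a..b}"
    have eqs: "X x = X0 c1 c2 x + lam * TX X Y x" "X' x = X0 c1' c2' x + lam * TX X' Y' x"
      "Y x = Y0 c1 c2 x + lam * TY X Y x" "Y' x = Y0 c1' c2' x + lam * TY X' Y' x"
      using assms x by (auto simp: fixed_point_def)
    show "c * X x + e * X' x = X0 (c * c1 + e * c1') (c * c2 + e * c2') x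
        + lam * TX (\<lambda>x. c * X x + e * X' x) (\<lambda>x. c * Y x + e * Y' x) x"
      "c * Y x + e * Y' x = Y0 (c * c1 + e * c1') (c * c2 + e * c2') x
        + lam * TY (\<lambda>x. c * X x + e * X' x) (\<lambda>x. c * Y x + e * Y' x) x"
      unfolding volterra_lincomb[OF A x c] volterra_lincomb[OF B x c] eqs
      by (simp_all add: X0_def Y0_def algebra_simps)
  qed (intro continuous_intros c)+
qed

text \<open>\<open>X0\<close> and \<open>Y0\<close> are linear in the initial values, so the
  difference of two fixed points solves the homogeneous equation.\<close>

lemma fixed_point_unique:
  assumes "fixed_point lam c1 c2 X Y" "fixed_point lam c1 c2 X' Y'" "x \<in> {a..b}"
  shows "X x = X' x" "Y x = Y' x"
proof -
  have "fixed_point lam (1 * c1 + (-1) * c1) (1 * c2 + (-1) * c2)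
    (\<lambda>x. 1 * X x + (-1) * X' x) (\<lambda>x. 1 * Y x + (-1) * Y' x)"
    by (rule fixed_point_lincomb[OF assms(1,2)])
  then have *: "fixed_point lam 0 0 (\<lambda>x. X x - X' x) (\<lambda>x. Y x - Y' x)" by simp
  let ?X = "\<lambda>x. X x - X' x" and ?Y = "\<lambda>x. Y x - Y' x"
  have cont: "continuous_on {a..b} ?X" "continuous_on {a..b} ?Y"
    using * by (auto simp: fixed_point_def)
  have eq: "?X s = lam * TX ?X ?Y s" "?Y s = lam * TY ?X ?Y s" if "s \<in> {a..b}" for s
    using * that by (auto simp: fixed_point_def X0_def Y0_def)
  show "X x = X' x" "Y x = Y' x"
    using fixed_point_zero[OF cont eq assms(3)] by auto
qed

text \<open>The coefficients of a given solution are the values of \<open>u / f\<close> and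
  \<open>v / g\<close> at \<open>x0\<close>; by uniqueness the combination with these coefficients
  is the solution itself.\<close>

lemma solution_iff:
  assumes "fixed_point lam 1 0 X1 Y1" "fixed_point lam 0 1 X2 Y2"
  shows "solution lam u v \<longleftrightarrow> (\<exists>c1 c2. \<forall>x\<in>{a..b}.
    u x = f x * (c1 * X1 x + c2 * X2 x) \<and> v x = g x * (c1 * Y1 x + c2 * Y2 x))"
proof
  assume sol: "solution lam u v"
  let ?c1 = "u x0 / f x0" and ?c2 = "v x0 / g x0"
  have "fixed_point lam (?c1 * 1 + ?c2 * 0) (?c1 * 0 + ?c2 * 1)
      (\<lambda>x. ?c1 * X1 x + ?c2 * X2 x) (\<lambda>x. ?c1 * Y1 x + ?c2 * Y2 x)"
    by (rule fixed_point_lincomb[OF assms])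
  then have 2: "fixed_point lam ?c1 ?c2 (\<lambda>x. ?c1 * X1 x + ?c2 * X2 x) (\<lambda>x. ?c1 * Y1 x + ?c2 * Y2 x)"
    by simp
  have "u x = f x * (?c1 * X1 x + ?c2 * X2 x) \<and> v x = g x * (?c1 * Y1 x + ?c2 * Y2 x)"
    if x: "x \<in> {a..b}" for x
    using fixed_point_unique[OF solution_imp_fixed_point[OF sol] 2 x] f0[OF x] g0[OF x]
    by (simp add: nonzero_divide_eq_eq mult.commute)
  then show "\<exists>c1 c2. \<forall>x\<in>{a..b}.
    u x = f x * (c1 * X1 x + c2 * X2 x) \<and> v x = g x * (c1 * Y1 x + c2 * Y2 x)" by blast
next
  assume "\<exists>c1 c2. \<forall>x\<in>{a..b}.
    u x = f x * (c1 * X1 x + c2 * X2 x) \<and> v x = g x * (c1 * Y1 x + c2 * Y2 x)"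
  then obtain c1 c2 where eq: "\<And>x. x \<in> {a..b} \<Longrightarrow> f x * (c1 * X1 x + c2 * X2 x) = u x"
      "\<And>x. x \<in> {a..b} \<Longrightarrow> g x * (c1 * Y1 x + c2 * Y2 x) = v x" by metis
  note sol = fixed_point_imp_solution[OF fixed_point_lincomb[OF assms, of c1 c2], unfolded solution_def]
  show "solution lam u v"
    unfolding solution_def
  proof
    show "ac_deriv a b u (\<lambda>x. q x * u x + p2 x * v x - lam * (r21 x * u x + r22 x * v x))"
      by (rule ac_deriv_cong_deriv[OF ac_deriv_cong[OF conjunct1[OF sol] eq(1)]]) (simp_all add: eq)
    show "ac_deriv a b v (\<lambda>x. - p1 x * u x - q x * v x + lam * (r11 x * u x + r12 x * v x))"
      by (rule ac_deriv_cong_deriv[OF ac_deriv_cong[OF conjunct2[OF sol] eq(2)]]) (simp_all add: eq)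
  qed
qed

end

section \<open>The series solutions\<close>

lemma mat2_nth [simp]:
  "mat2 m11 m12 m21 m22 $ 1 $ 1 = m11" "mat2 m11 m12 m21 m22 $ 1 $ 2 = m12"
  "mat2 m11 m12 m21 m22 $ 2 $ 1 = m21" "mat2 m11 m12 m21 m22 $ 2 $ 2 = m22"
  by (simp_all add: mat2_def vector_2)

lemma mat2_mult_vec:
  "mat2 m11 m12 m21 m22 *v y = vector [m11 * y $ 1 + m12 * y $ 2, m21 * y $ 1 + m22 * y $ 2]"
  by (simp add: vec_eq_iff forall_2 matrix_vector_mult_def sum_2 vector_2)

lemma has_vector_derivative_vec2_iff:
  fixes Y :: "real \<Rightarrow> complex ^ 2"
  shows "(Y has_vector_derivative Y') F \<longleftrightarrow>
    ((\<lambda>x. Y x $ 1) has_vector_derivative Y' $ 1) F \<and> ((\<lambda>x. Y x $ 2) has_vector_derivative Y' $ 2) F"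
proof safe
  assume *: "(Y has_vector_derivative Y') F"
  show "((\<lambda>x. Y x $ 1) has_vector_derivative Y' $ 1) F" "((\<lambda>x. Y x $ 2) has_vector_derivative Y' $ 2) F"
    by (rule bounded_linear.has_vector_derivative[OF bounded_linear_vec_nth *])+
next
  assume *: "((\<lambda>x. Y x $ 1) has_vector_derivative Y' $ 1) F" "((\<lambda>x. Y x $ 2) has_vector_derivative Y' $ 2) F"
  have axis: "bounded_linear (axis i :: complex \<Rightarrow> complex ^ 2)" for i
    by (intro linear_conv_bounded_linear[THEN iffD1] linearI) (auto simp: axis_def vec_eq_iff)
  note has_vector_derivative_add[OF bounded_linear.has_vector_derivative[OF axis[of 1] *(1)]
      bounded_linear.has_vector_derivative[OF axis[of 2] *(2)]]
  moreover have "axis 1 (y $ 1) + axis 2 (y $ 2) = y" for y :: "complex ^ 2"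
    by (simp add: vec_eq_iff forall_2 axis_def)
  ultimately show "(Y has_vector_derivative Y') F" by simp
qed

text \<open>\<open>B\<close> is invertible, so the equation determines \<open>Y'\<close> and the
  existential quantifier disappears. The right-hand side is left arbitrary to cover both the
  homogeneous system and the one with \<open>lam\<close>.\<close>

lemma solves_iff_ac_deriv:
  "solves a b (\<lambda>x. mat2 (p1 x) (q x) (q x) (p2 x)) h Y \<longleftrightarrow>
     ac_deriv a b (\<lambda>x. Y x $ 1) (\<lambda>x. q x * Y x $ 1 + p2 x * Y x $ 2 - h x $ 2) \<and>
     ac_deriv a b (\<lambda>x. Y x $ 2) (\<lambda>x. h x $ 1 - p1 x * Y x $ 1 - q x * Y x $ 2)"
proof -
  have "(\<exists>Y'. (Y has_vector_derivative Y') F \<and>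
          mat2 0 1 (-1) 0 *v Y' + mat2 (p1 x) (q x) (q x) (p2 x) *v Y x = h x) \<longleftrightarrow>
      ((\<lambda>x. Y x $ 1) has_vector_derivative (q x * Y x $ 1 + p2 x * Y x $ 2 - h x $ 2)) F \<and>
      ((\<lambda>x. Y x $ 2) has_vector_derivative (h x $ 1 - p1 x * Y x $ 1 - q x * Y x $ 2)) F" for x F
  proof -
    have "mat2 0 1 (-1) 0 *v Y' + mat2 (p1 x) (q x) (q x) (p2 x) *v Y x = h x \<longleftrightarrow>
        Y' = vector [q x * Y x $ 1 + p2 x * Y x $ 2 - h x $ 2, h x $ 1 - p1 x * Y x $ 1 - q x * Y x $ 2]" for Y'
      by (auto simp: mat2_mult_vec vec_eq_iff forall_2 vector_2 algebra_simps)
    then show ?thesis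
      by (simp add: has_vector_derivative_vec2_iff vector_2)
  qed
  then show ?thesis
    unfolding solves_def ac_deriv_def forall_2 by (auto simp: imp_conjR)
qed

section \<open>Formal powers as scaled iterates\<close>

context dirac_system
begin

abbreviation "P \<equiv> \<lambda>x. mat2 (p1 x) (q x) (q x) (p2 x)"
abbreviation "R \<equiv> \<lambda>x. mat2 (r11 x) (r12 x) (r21 x) (r22 x)"

lemma solves_iff_solution:
  "solves a b P (\<lambda>x. lam *s (R x *v Y x)) Y \<longleftrightarrow> solution lam (\<lambda>x. Y x $ 1) (\<lambda>x. Y x $ 2)"
  unfolding solves_iff_ac_deriv solution_def
  by (simp add: mat2_mult_vec vector_2 algebra_simps)

lemma powers_Suc_volterra:
  fixes X Y
  defines "XY \<equiv> powers f g P R x0 X Y"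
  shows "fst (XY (Suc n)) x = of_nat (Suc n) * TX (fst (XY n)) (snd (XY n)) x"
    and "snd (XY (Suc n)) x = of_nat (Suc n) * TY (fst (XY n)) (snd (XY n)) x"
  by (simp_all add: XY_def volterra_def coupling_def Z_of_def Let_def split_beta mult.commute)

definition series_X :: "complex \<Rightarrow> complex \<Rightarrow> complex \<Rightarrow> nat \<Rightarrow> real \<Rightarrow> complex" where
  "series_X lam c1 c2 n x = lam ^ n / fact n * fst (powers f g P R x0 (X0 c1 c2) (Y0 c1 c2) n) x"

definition series_Y :: "complex \<Rightarrow> complex \<Rightarrow> complex \<Rightarrow> nat \<Rightarrow> real \<Rightarrow> complex" where
  "series_Y lam c1 c2 n x = lam ^ n / fact n * snd (powers f g P R x0 (X0 c1 c2) (Y0 c1 c2) n) x"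

lemma series_0: "series_X lam c1 c2 0 = X0 c1 c2" "series_Y lam c1 c2 0 = Y0 c1 c2"
  by (simp_all add: series_X_def series_Y_def fun_eq_iff)

text \<open>The factor \<open>n + 1\<close> of the recursion cancels against the factorial. This
  turns the scaled formal powers into iterates of \<open>lam * T\<close>.\<close>

lemma series_Suc:
  "series_X lam c1 c2 (Suc n) x = lam * TX (series_X lam c1 c2 n) (series_Y lam c1 c2 n) x"
  "series_Y lam c1 c2 (Suc n) x = lam * TY (series_X lam c1 c2 n) (series_Y lam c1 c2 n) x"
proof -
  have *: "lam ^ Suc n / fact (Suc n) * (of_nat (Suc n) * z) = lam * (lam ^ n / fact n * z)" for z :: complex
    by (simp add: fact_Suc del: of_nat_Suc)
  show "series_X lam c1 c2 (Suc n) x = lam * TX (series_X lam c1 c2 n) (series_Y lam c1 c2 n) x"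
    "series_Y lam c1 c2 (Suc n) x = lam * TY (series_X lam c1 c2 n) (series_Y lam c1 c2 n) x"
    unfolding series_X_def series_Y_def powers_Suc_volterra * volterra_cmult by simp_all
qed

lemma base_continuous: "continuous_on {a..b} (X0 c1 c2)" "continuous_on {a..b} (Y0 c1 c2)"
  unfolding X0_def Y0_def
  by (intro continuous_intros ac_deriv_continuous_on[OF ac_deriv_int_from] quot x0)+

lemma series_0_continuous:
  "continuous_on {a..b} (series_X lam c1 c2 0)" "continuous_on {a..b} (series_Y lam c1 c2 0)"
  by (simp_all add: series_0 base_continuous)

lemma fixed_point_series:
  "fixed_point lam c1 c2 (\<lambda>x. \<Sum>n. series_X lam c1 c2 n x) (\<lambda>x. \<Sum>n. series_Y lam c1 c2 n x)"
  unfolding fixed_point_def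
  using iterates_sum[of "series_X lam c1 c2" "series_Y lam c1 c2" lam, OF series_0_continuous series_Suc]
  by (simp add: series_0)

lemma series_bound:
  obtains M where "\<And>n x. x \<in> {a..b} \<Longrightarrow> norm (series_X lam c1 c2 n x) \<le> M * (1/2)^n"
    and "\<And>n x. x \<in> {a..b} \<Longrightarrow> norm (series_Y lam c1 c2 n x) \<le> M * (1/2)^n"
  using iterates_bound[of "series_X lam c1 c2" "series_Y lam c1 c2" lam, OF series_0_continuous series_Suc]
  by blast

lemma series_term_eq:
  "series_term f g (powers f g P R x0 (X0 c1 c2) (Y0 c1 c2)) lam n x
     = vector [f x * series_X lam c1 c2 n x, g x * series_Y lam c1 c2 n x]"
  by (simp add: series_term_def series_X_def series_Y_def vec_eq_iff forall_2 vector_2)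

text \<open>The geometric bound on the scalar series, multiplied by bounds for \<open>f\<close> and
  \<open>g\<close>, is a majorant for the vector series.\<close>

lemma series_term_uniform_limit:
  fixes lam c1 c2
  defines "t \<equiv> series_term f g (powers f g P R x0 (X0 c1 c2) (Y0 c1 c2)) lam"
  shows "uniform_limit {a..b} (\<lambda>N x. \<Sum>n<N. t n x) (\<lambda>x. \<Sum>n. t n x) sequentially"
proof -
  obtain M where M: "\<And>n x. x \<in> {a..b} \<Longrightarrow> norm (series_X lam c1 c2 n x) \<le> M * (1/2)^n"
      "\<And>n x. x \<in> {a..b} \<Longrightarrow> norm (series_Y lam c1 c2 n x) \<le> M * (1/2)^n"
    using series_bound by blast
  have "bounded (f ` {a..b})" "bounded (g ` {a..b})"
    using f g by (auto intro!: compact_imp_bounded compact_continuous_image intro: ac_deriv_continuous_on)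
  then obtain Mf Mg where Mf: "\<And>x. x \<in> {a..b} \<Longrightarrow> norm (f x) \<le> Mf"
    and Mg: "\<And>x. x \<in> {a..b} \<Longrightarrow> norm (g x) \<le> Mg"
    unfolding bounded_iff by (metis image_eqI)
  show ?thesis
  proof (rule Weierstrass_m_test[where M = "\<lambda>n. (Mf + Mg) * M * (1/2)^n"])
    show "summable (\<lambda>n. (Mf + Mg) * M * (1/2::real)^n)"
      by (intro summable_mult summable_geometric) simp
    fix n x assume x: "x \<in> {a..b}"
    have "norm (t n x) \<le> (\<Sum>i\<in>UNIV. norm (t n x $ i))"
      unfolding norm_vec_def by (rule L2_set_le_sum) simp
    also have "\<dots> = norm (f x) * norm (series_X lam c1 c2 n x) + norm (g x) * norm (series_Y lam c1 c2 n x)"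
      by (simp add: t_def series_term_eq sum_2 vector_2 norm_mult)
    also have "\<dots> \<le> Mf * (M * (1/2)^n) + Mg * (M * (1/2)^n)"
      using Mf[OF x] Mg[OF x] M[OF x]
      by (intro add_mono mult_mono) (auto intro: order_trans[OF norm_ge_zero])
    finally show "norm (t n x) \<le> (Mf + Mg) * M * (1/2)^n"
      by (simp add: algebra_simps)
  qed
qed

text \<open>The vector sum is split through the limit of its partial sums; summability of the scalar
  series then allows \<open>f x\<close> and \<open>g x\<close> to be pulled out.\<close>

lemma series_term_suminf:
  assumes x: "x \<in> {a..b}"
  shows "(\<Sum>n. series_term f g (powers f g P R x0 (X0 c1 c2) (Y0 c1 c2)) lam n x)
    = vector [f x * (\<Sum>n. series_X lam c1 c2 n x), g x * (\<Sum>n. series_Y lam c1 c2 n x)]" (is "?S = _")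
proof -
  obtain M where M: "\<And>n. norm (series_X lam c1 c2 n x) \<le> M * (1/2)^n"
      "\<And>n. norm (series_Y lam c1 c2 n x) \<le> M * (1/2)^n"
    using series_bound[of lam c1 c2] x by metis
  have sm: "summable (\<lambda>n. M * (1/2::real)^n)"
    by (intro summable_mult summable_geometric) simp
  have s: "summable (\<lambda>n. series_X lam c1 c2 n x)" "summable (\<lambda>n. series_Y lam c1 c2 n x)"
    by (rule summable_comparison_test'[OF sm], rule M)+
  have "(\<lambda>N. \<Sum>n<N. series_term f g (powers f g P R x0 (X0 c1 c2) (Y0 c1 c2)) lam n x) \<longlonglongrightarrow> ?S"
    using tendsto_uniform_limitI[OF series_term_uniform_limit x] .
  from tendsto_vec_nth[OF this, of 1] tendsto_vec_nth[OF this, of 2] have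
    "(\<lambda>n. f x * series_X lam c1 c2 n x) sums (?S $ 1)" "(\<lambda>n. g x * series_Y lam c1 c2 n x) sums (?S $ 2)"
    by (simp_all add: sums_def series_term_eq vector_2)
  then have "?S $ 1 = (\<Sum>n. f x * series_X lam c1 c2 n x)" "?S $ 2 = (\<Sum>n. g x * series_Y lam c1 c2 n x)"
    by (simp_all add: sums_iff)
  then show ?thesis
    using s by (simp add: vec_eq_iff forall_2 vector_2 suminf_mult)
qed

lemma formal_powers_eq:
  "formal_powers f g P R x0 = powers f g P R x0 (X0 0 1) (Y0 0 1)"
  "formal_powers_tilde f g P R x0 = powers f g P R x0 (X0 1 0) (Y0 1 0)"
  by (simp_all add: formal_powers_def formal_powers_tilde_def X0_def[abs_def] Y0_def[abs_def])

lemma fixed_point_base: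
  assumes "fixed_point lam c1 c2 X Y"
  shows "X x0 = c1" "Y x0 = c2"
  using assms x0 by (auto simp: fixed_point_def X0_def Y0_def volterra_def int_from_self)

theorem general_solution:
  fixes lam
  defines "Y1 \<equiv> \<lambda>x. \<Sum>n. series_term f g (formal_powers_tilde f g P R x0) lam n x"
    and "Y2 \<equiv> \<lambda>x. \<Sum>n. series_term f g (formal_powers f g P R x0) lam n x"
  shows "solves a b P (\<lambda>x. lam *s (R x *v Y x)) Y \<longleftrightarrow>
            (\<exists>c1 c2. \<forall>x\<in>{a..b}. Y x = c1 *s Y1 x + c2 *s Y2 x)"
    and "uniform_limit {a..b}
            (\<lambda>N x. \<Sum>n<N. series_term f g (formal_powers_tilde f g P R x0) lam n x) Y1 sequentially"
    and "uniform_limit {a..b}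
            (\<lambda>N x. \<Sum>n<N. series_term f g (formal_powers f g P R x0) lam n x) Y2 sequentially"
    and "Y1 x0 = vector [f x0, 0]"
    and "Y2 x0 = vector [0, g x0]"
proof -
  have Y1: "Y1 x = vector [f x * (\<Sum>n. series_X lam 1 0 n x), g x * (\<Sum>n. series_Y lam 1 0 n x)]"
    and Y2: "Y2 x = vector [f x * (\<Sum>n. series_X lam 0 1 n x), g x * (\<Sum>n. series_Y lam 0 1 n x)]"
    if "x \<in> {a..b}" for x
    unfolding Y1_def Y2_def formal_powers_eq by (rule series_term_suminf[OF that])+
  show "solves a b P (\<lambda>x. lam *s (R x *v Y x)) Y \<longleftrightarrow>
            (\<exists>c1 c2. \<forall>x\<in>{a..b}. Y x = c1 *s Y1 x + c2 *s Y2 x)"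
    unfolding solves_iff_solution solution_iff[OF fixed_point_series fixed_point_series]
    by (simp add: Y1 Y2 vec_eq_iff forall_2 vector_2 algebra_simps)
  show "uniform_limit {a..b}
      (\<lambda>N x. \<Sum>n<N. series_term f g (formal_powers_tilde f g P R x0) lam n x) Y1 sequentially"
    "uniform_limit {a..b}
      (\<lambda>N x. \<Sum>n<N. series_term f g (formal_powers f g P R x0) lam n x) Y2 sequentially"
    unfolding Y1_def Y2_def formal_powers_eq by (rule series_term_uniform_limit)+
  show "Y1 x0 = vector [f x0, 0]" "Y2 x0 = vector [0, g x0]"
    unfolding Y1[OF x0] Y2[OF x0] fixed_point_base[OF fixed_point_series] by simp_all
qed

end

theorem mainTheorem4:
  fixes a b x0 :: real
    and p1 p2 q r11 r12 r21 r22 f g :: "real \<Rightarrow> complex"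
    and lam :: complex
    and P R :: "real \<Rightarrow> complex ^ 2 ^ 2"
    and Y1 Y2 :: "real \<Rightarrow> complex ^ 2"
  defines "P \<equiv> \<lambda>x. mat2 (p1 x) (q x) (q x) (p2 x)"
    and "R \<equiv> \<lambda>x. mat2 (r11 x) (r12 x) (r21 x) (r22 x)"
    and "Y1 \<equiv> \<lambda>x. \<Sum>n. series_term f g (formal_powers_tilde f g P R x0) lam n x"
    and "Y2 \<equiv> \<lambda>x. \<Sum>n. series_term f g (formal_powers f g P R x0) lam n x"
  assumes "a < b" and "x0 \<in> {a..b}"
    and "p1 absolutely_integrable_on {a..b}"
    and "p2 absolutely_integrable_on {a..b}"
    and "q absolutely_integrable_on {a..b}"
    and "r11 absolutely_integrable_on {a..b}"
    and "r12 absolutely_integrable_on {a..b}"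
    and "r21 absolutely_integrable_on {a..b}"
    and "r22 absolutely_integrable_on {a..b}"
    and "solves a b P (\<lambda>x. 0) (\<lambda>x. vector [f x, g x])"
    and "AE x\<in>{a..b} in lebesgue. f x \<noteq> 0"
    and "AE x\<in>{a..b} in lebesgue. g x \<noteq> 0"
    and "(\<lambda>x. p2 x / (f x)\<^sup>2) absolutely_integrable_on {a..b}"
    and "(\<lambda>x. p1 x / (g x)\<^sup>2) absolutely_integrable_on {a..b}"
    and "(\<lambda>x. r11 x * (f x / g x)) absolutely_integrable_on {a..b}"
    and "(\<lambda>x. r22 x * (g x / f x)) absolutely_integrable_on {a..b}"
  shows "(\<forall>Y. solves a b P (\<lambda>x. lam *s (R x *v Y x)) Y \<longleftrightarrow>
            (\<exists>c1 c2. \<forall>x\<in>{a..b}. Y x = c1 *s Y1 x + c2 *s Y2 x))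
       \<and> uniform_limit {a..b}
            (\<lambda>N x. \<Sum>n<N. series_term f g (formal_powers_tilde f g P R x0) lam n x) Y1 sequentially
       \<and> uniform_limit {a..b}
            (\<lambda>N x. \<Sum>n<N. series_term f g (formal_powers f g P R x0) lam n x) Y2 sequentially
       \<and> Y1 x0 = vector [f x0, 0]
       \<and> Y2 x0 = vector [0, g x0]"
proof -
  note nz = \<open>AE x\<in>{a..b} in lebesgue. f x \<noteq> 0\<close> \<open>AE x\<in>{a..b} in lebesgue. g x \<noteq> 0\<close>
  note quot = \<open>(\<lambda>x. p2 x / (f x)\<^sup>2) absolutely_integrable_on {a..b}\<close>
    \<open>(\<lambda>x. p1 x / (g x)\<^sup>2) absolutely_integrable_on {a..b}\<close>
  have f: "ac_deriv a b f (\<lambda>x. q x * f x + p2 x * g x)"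
    and g: "ac_deriv a b g (\<lambda>x. - p1 x * f x - q x * g x)"
    using \<open>solves a b P (\<lambda>x. 0) (\<lambda>x. vector [f x, g x])\<close>
    unfolding P_def solves_iff_ac_deriv by (simp_all add: vector_2)
  have cont: "continuous_on {a..b} (\<lambda>x. f x * g x)"
    by (intro continuous_on_mult ac_deriv_continuous_on[OF f] ac_deriv_continuous_on[OF g])
  \<comment> \<open>The coefficient in \<open>f' = k f\<close> is formally
    \<open>q + p2 g / f\<close>. Written as \<open>p2 / f^2\<close> times the continuous function
    \<open>f g\<close>, its second term is visibly integrable.\<close>
  have kf: "(\<lambda>x. q x + p2 x / (f x)\<^sup>2 * (f x * g x)) absolutely_integrable_on {a..b}"
    by (intro set_integral_add absolutely_integrable_mult_continuous cont quot
        \<open>q absolutely_integrable_on {a..b}\<close>)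
  have kg: "(\<lambda>x. - 1 * (q x + p1 x / (g x)\<^sup>2 * (f x * g x))) absolutely_integrable_on {a..b}"
    by (intro set_integrable_mult_right set_integral_add absolutely_integrable_mult_continuous cont quot
        \<open>q absolutely_integrable_on {a..b}\<close>)
  \<comment> \<open>At a zero of \<open>f\<close> the quotient by \<open>f^2\<close> is 0 by
    convention, and \<open>f' = k f\<close> may fail there. The equation is therefore obtained only
    almost everywhere, which suffices to exclude such zeros.\<close>
  have f0: "f x \<noteq> 0" if "x \<in> {a..b}" for x
    by (rule ac_deriv_linear_nonzero[OF \<open>a < b\<close> f kf _ nz(1) that], rule AE_lebesgue_mono[OF nz(1)])
      (simp add: field_simps power2_eq_square)
  have g0: "g x \<noteq> 0" if "x \<in> {a..b}" for x
    by (rule ac_deriv_linear_nonzero[OF \<open>a < b\<close> g kg _ nz(2) that], rule AE_lebesgue_mono[OF nz(2)])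
      (simp add: field_simps power2_eq_square)
  interpret dirac_system a b x0 p1 p2 q r11 r12 r21 r22 f g
    by unfold_locales (fact assms | fact f | fact g | rule f0 g0, assumption)+
  show ?thesis
    unfolding P_def R_def Y1_def Y2_def
    by (intro conjI allI general_solution)
qed

end
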